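(* Let $D$ be a finite-dimensional division algebra over a field $k$. Then $\mathcal{DC}(D,\mathrm{id})\simeq D[[x]]^{\circ}$ as coalgebras.
   Context: $D[[x]]$ is the power series ring over $D$ in one variable $x$ commuting with the elements of $D$. For a $k$-algebra $A$, the finite dual $A^\circ$ is the coalgebra of all $f\in\mathrm{Hom}_k(A,k)$ whose kernel contains a two-sided ideal of finite codimension. $D^*=\mathrm{Hom}_k(D,k)$ is the dual coalgebra of $D$; regarding $D$ as a $D$-bimodule by left and right multiplication, its dual $D^*$ is a $D^*$-bicomodule (with both coactions equal to the comultiplication). $\mathcal{DC}(D,\mathrm{id}):=T_{D^*}(D^* )$ for this bicomodule, where for a coalgebra $C$ and a $C$-bicomodule $N$ with left coaction $\rho^l$ and right coaction $\rho^r$, the cotensor product $N\Box_C N$ is the kernel of $\rho^r\otimes \mathrm{id}-\mathrm{id}\otimes\rho^l: N\otimes N\to N\otimes C\otimes N$ (similarly for iterated ones), and the cotensor coalgebra is $T_C(N)=\bigoplus_{n\ge 0}N^{\Box_C n}$ with $N^{\Box_C 0}=C$, $N^{\Box_C 1}=N$, and $N^{\Box_C n}$ the $n$-fold cotensor product. Its comultiplication is $\Delta_C$ on $C$, $\Delta(m)=\rho^l(m)+\rho^r(m)$ for $m\in N$, and for $n\ge2$ $$\Delta(m_1\Box\cdots\Box m_n)=\sum (m_1)_{-1}\otimes((m_1)_0\Box m_2\Box\cdots\Box m_n)+\sum_{i=1}^{n-1}(m_1\Box\cdots\Box m_i)\otimes(m_{i+1}\Box\cdots\Box m_n)+\sum(m_1\Box\cdots\Box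 m_{n-1}\Box(m_n)_0)\otimes(m_n)_1,$$ where $\rho^l(m_1)=\sum (m_1)_{-1}\otimes(m_1)_0$ and $\rho^r(m_n)=\sum(m_n)_0\otimes(m_n)_1$; its counit is $\varepsilon_C$ on $C$ and $0$ on $N^{\Box_C n}$ for $n\ge1$. *)

theory Defs
  imports
    Complex_Main
    "HOL-Library.Function_Algebras"
    "HOL-Computational_Algebra.Formal_Power_Series"
begin

text \<open>
  A vector space over the field \<open>'k\<close> is given by a scalar multiplication \<open>sc\<close> turning a type \<open>'v\<close>
  into a vector space together with a subspace of \<open>'v\<close>, the carrier. Addition on function types
  is pointwise (theory Function_Algebras).
\<close>

definition fscale :: "'k::field \<Rightarrow> ('y \<Rightarrow> 'k) \<Rightarrow> 'y \<Rightarrow> 'k" where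
  "fscale c f = (\<lambda>y. c * f y)"

definition linear_on ::
  "('k \<Rightarrow> 'v::plus \<Rightarrow> 'v) \<Rightarrow> ('k \<Rightarrow> 'w::plus \<Rightarrow> 'w) \<Rightarrow> 'v set \<Rightarrow> ('v \<Rightarrow> 'w) \<Rightarrow> bool" where
  "linear_on s1 s2 V f \<longleftrightarrow>
     (\<forall>x\<in>V. \<forall>y\<in>V. f (x + y) = f x + f y) \<and> (\<forall>c. \<forall>x\<in>V. f (s1 c x) = s2 c (f x))"


subsection \<open>Tensor products\<close>

text \<open>
  The tensor \<open>v\<^sub>1 \<otimes> \<dots> \<otimes> v\<^sub>n\<close> of a word of vectors is represented by evaluation
  \<open>\<beta> \<mapsto> \<beta> (v\<^sub>1, \<dots>, v\<^sub>n)\<close> on multilinear forms. A form \<open>\<beta>\<close> is defined on words of every length and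
  is multilinear in each length separately, so words of different lengths are independent.
  Since multilinear forms separate the elements of a tensor product over a field, the span of these
  functionals over all words with \<open>v\<^sub>i \<in> V\<^sub>i\<close> is a tensor product \<open>V\<^sub>1 \<otimes> \<dots> \<otimes> V\<^sub>n\<close>, as is proved
  below in the form of the universal property (pure_multilinear, tensor_lift_universal,
  tensor_lift_unique).
\<close>

type_synonym ('v, 'k) tensor = "('v list \<Rightarrow> 'k) \<Rightarrow> 'k"

definition multilinear_form :: "('k::field \<Rightarrow> 'v::ab_group_add \<Rightarrow> 'v) \<Rightarrow> ('v list \<Rightarrow> 'k) \<Rightarrow> bool" where
  "multilinear_form sc \<beta> \<longleftrightarrow>
     (\<forall>us vs x y. \<beta> (us @ (x + y) # vs) = \<beta> (us @ x # vs) + \<beta> (us @ y # vs)) \<and>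
     (\<forall>us vs c x. \<beta> (us @ sc c x # vs) = c * \<beta> (us @ x # vs))"

definition pure_tensor :: "('k::field \<Rightarrow> 'v::ab_group_add \<Rightarrow> 'v) \<Rightarrow> 'v list \<Rightarrow> ('v, 'k) tensor" where
  "pure_tensor sc ws = (\<lambda>\<beta>. if multilinear_form sc \<beta> then \<beta> ws else 0)"

definition tensor_space ::
  "('k::field \<Rightarrow> 'v::ab_group_add \<Rightarrow> 'v) \<Rightarrow> 'v set list \<Rightarrow> ('v, 'k) tensor set" where
  "tensor_space sc Vs = module.span fscale (pure_tensor sc ` listset Vs)"

definition tensor_mult ::
  "('k::field \<Rightarrow> 'v::ab_group_add \<Rightarrow> 'v) \<Rightarrow> ('v, 'k) tensor \<Rightarrow> ('v, 'k) tensor \<Rightarrow> ('v, 'k) tensor" where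
  "tensor_mult sc t u =
     (\<lambda>\<beta>. if multilinear_form sc \<beta> then t (\<lambda>xs. u (\<lambda>ys. \<beta> (xs @ ys))) else 0)"

text \<open>
  The linear map on \<open>V\<^sub>1 \<otimes> \<dots> \<otimes> V\<^sub>n\<close> induced by a map \<open>\<phi>\<close> multilinear on \<open>V\<^sub>1 \<times> \<dots> \<times> V\<^sub>n\<close>;
  its values outside the tensor space are irrelevant.
\<close>

definition tensor_lift ::
  "('k::field \<Rightarrow> 'v::ab_group_add \<Rightarrow> 'v) \<Rightarrow> 'v set list \<Rightarrow> ('v list \<Rightarrow> 'y \<Rightarrow> 'k) \<Rightarrow>
   ('v, 'k) tensor \<Rightarrow> 'y \<Rightarrow> 'k" where
  "tensor_lift sc Vs \<phi> = (SOME L. linear_on fscale fscale (tensor_space sc Vs) L \<and>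
     (\<forall>ws\<in>listset Vs. L (pure_tensor sc ws) = \<phi> ws))"

lemma listset_iff: "ws \<in> listset Vs \<longleftrightarrow> length ws = length Vs \<and> (\<forall>i<length Vs. ws ! i \<in> Vs ! i)"
proof (induction Vs arbitrary: ws)
  case (Cons V Vs)
  then show ?case
    by (cases ws) (auto simp: set_Cons_def less_Suc_eq_0_disj)
qed auto

definition multilinear_on ::
  "('k::field \<Rightarrow> 'v::ab_group_add \<Rightarrow> 'v) \<Rightarrow> 'v set list \<Rightarrow> ('v list \<Rightarrow> 'y \<Rightarrow> 'k) \<Rightarrow> bool" where
  "multilinear_on sc Vs \<phi> \<longleftrightarrow> (\<forall>i<length Vs. \<forall>ws\<in>listset Vs.
     linear_on sc fscale (Vs ! i) (\<lambda>x. \<phi> (ws[i := x])))"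

lemma vector_space_fscale: "vector_space fscale"
  by unfold_locales (auto simp: fscale_def fun_eq_iff algebra_simps)

theorem tensor_lift_universal:
  fixes sc :: "'k::field \<Rightarrow> 'v::ab_group_add \<Rightarrow> 'v" and \<phi> :: "'v list \<Rightarrow> 'y \<Rightarrow> 'k"
  assumes vs: "vector_space sc" and sub: "\<And>V. V \<in> set Vs \<Longrightarrow> module.subspace sc V"
    and ml: "multilinear_on sc Vs \<phi>"
  shows "linear_on fscale fscale (tensor_space sc Vs) (tensor_lift sc Vs \<phi>)"
    and "ws \<in> listset Vs \<Longrightarrow> tensor_lift sc Vs \<phi> (pure_tensor sc ws) = \<phi> ws"
proof -
  interpret vs: vector_space sc by fact
  interpret pr: vector_space_pair sc sc ..
  have "\<exists>p. range p \<subseteq> V \<and> Vector_Spaces.linear sc sc p \<and> (\<forall>v\<in>V. p v = v)" if "V \<in> set Vs" for V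
    using pr.linear_exists_left_inverse_on[OF vs.linear_ident sub[OF that]] by auto
  then have "\<exists>p. \<forall>V\<in>set Vs. range (p V) \<subseteq> V \<and> Vector_Spaces.linear sc sc (p V) \<and> (\<forall>v\<in>V. p V v = v)"
    by metis
  then obtain p where p: "\<And>V. V \<in> set Vs \<Longrightarrow> range (p V) \<subseteq> V \<and> Vector_Spaces.linear sc sc (p V) \<and> (\<forall>v\<in>V. p V v = v)"
    by blast
  define P where "P ws = map2 p Vs ws" for ws
  define \<psi> where "\<psi> y ws = (if length ws = length Vs then \<phi> (P ws) y else 0)" for y ws
  define L where "L t = (\<lambda>y. t (\<psi> y))" for t :: "('v, 'k) tensor"
  have P_in: "P ws \<in> listset Vs" if "length ws = length Vs" for ws
  proof -
    have "p (Vs ! i) (ws ! i) \<in> Vs ! i" if "i < length Vs" for i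
      using p[of "Vs ! i"] that by auto
    then show ?thesis using that by (simp add: listset_iff P_def)
  qed
  have P_upd: "P (us @ x # vs) = (P (us @ 0 # vs))[length us := p (Vs ! length us) x]"
    if "length (us @ x # vs) = length Vs" for us x vs
    using that by (intro nth_equalityI) (auto simp: P_def nth_append nth_list_update nth_Cons')
  have lin: "Vector_Spaces.linear sc sc (p (Vs ! i))" "p (Vs ! i) x \<in> Vs ! i" if "i < length Vs" for i x
    using p[of "Vs ! i"] that by auto
  have \<psi>: "multilinear_form sc (\<psi> y)" for y
    unfolding multilinear_form_def
  proof (intro conjI allI)
    fix us vs x x' c
    show "\<psi> y (us @ (x + x') # vs) = \<psi> y (us @ x # vs) + \<psi> y (us @ x' # vs)"
    proof (cases "length (us @ x # vs) = length Vs")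
      case True
      let ?i = "length us"
      have i: "?i < length Vs" using True by simp
      have "P (us @ 0 # vs) \<in> listset Vs" using True by (intro P_in) auto
      with ml i have "linear_on sc fscale (Vs ! ?i) (\<lambda>x. \<phi> ((P (us @ 0 # vs))[?i := x]))"
        by (auto simp: multilinear_on_def)
      then show ?thesis
        using True lin[OF i]
        by (simp add: \<psi>_def linear_on_def pr.linear_add P_upd[of us x vs] P_upd[of us x' vs]
            P_upd[of us "x + x'" vs])
    qed (auto simp: \<psi>_def)
    show "\<psi> y (us @ sc c x # vs) = c * \<psi> y (us @ x # vs)"
    proof (cases "length (us @ x # vs) = length Vs")
      case True
      let ?i = "length us"
      have i: "?i < length Vs" using True by simp
      have "P (us @ 0 # vs) \<in> listset Vs" using True by (intro P_in) auto
      with ml i have "linear_on sc fscale (Vs ! ?i) (\<lambda>x. \<phi> ((P (us @ 0 # vs))[?i := x]))"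
        by (auto simp: multilinear_on_def)
      then show ?thesis
        using True lin[OF i]
        by (simp add: \<psi>_def linear_on_def pr.linear_scale fscale_def P_upd[of us x vs]
            P_upd[of us "sc c x" vs])
    qed (auto simp: \<psi>_def)
  qed
  have Pid: "P ws = ws" if "ws \<in> listset Vs" for ws
    using that p by (intro nth_equalityI) (auto simp: P_def listset_iff)
  let ?Q = "\<lambda>L. linear_on fscale fscale (tensor_space sc Vs) L \<and>
     (\<forall>ws\<in>listset Vs. L (pure_tensor sc ws) = \<phi> ws)"
  have "?Q L"
    using \<psi> Pid by (auto simp: linear_on_def L_def fscale_def pure_tensor_def \<psi>_def listset_iff)
  then have Q: "?Q (tensor_lift sc Vs \<phi>)"
    unfolding tensor_lift_def by (rule someI[where P = ?Q])
  then show "linear_on fscale fscale (tensor_space sc Vs) (tensor_lift sc Vs \<phi>)"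
    and "ws \<in> listset Vs \<Longrightarrow> tensor_lift sc Vs \<phi> (pure_tensor sc ws) = \<phi> ws" by auto
qed

theorem tensor_lift_unique:
  assumes "linear_on fscale fscale (tensor_space sc Vs) L" "linear_on fscale fscale (tensor_space sc Vs) L'"
    and eq: "\<And>ws. ws \<in> listset Vs \<Longrightarrow> L (pure_tensor sc ws) = L' (pure_tensor sc ws)"
    and t: "t \<in> tensor_space sc Vs"
  shows "L t = L' t"
proof -
  interpret F: vector_space "fscale :: 'a \<Rightarrow> (('b list \<Rightarrow> 'a) \<Rightarrow> 'a) \<Rightarrow> _" by (rule vector_space_fscale)
  interpret G: vector_space "fscale :: 'a \<Rightarrow> ('c \<Rightarrow> 'a) \<Rightarrow> _" by (rule vector_space_fscale)
  let ?T = "tensor_space sc Vs"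
  have lin: "L (x + y) = L x + L y" "L' (x + y) = L' x + L' y"
    "L (fscale c x) = fscale c (L x)" "L' (fscale c x) = fscale c (L' x)"
    if "x \<in> ?T" "y \<in> ?T" for x y c
    using assms(1,2) that by (auto simp: linear_on_def)
  have z: "0 \<in> ?T" by (simp add: tensor_space_def F.span_zero)
  have "t \<in> ?T \<and> L t = L' t"
    using t unfolding tensor_space_def
  proof (induction rule: F.span_induct_alt)
    case base
    have "L 0 = 0" "L' 0 = 0" using lin(3,4)[OF z z, of 0] by auto
    then show ?case using z by (simp add: tensor_space_def zero_fun_def)
  next
    case (step c x y)
    then have "x \<in> ?T" by (auto simp: tensor_space_def intro: F.span_base)
    moreover from this have "fscale c x \<in> ?T" by (simp add: tensor_space_def F.span_scale)
    moreover have "y \<in> ?T" using step by (simp add: tensor_space_def)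
    moreover have "L x = L' x" using step eq by auto
    moreover have "fscale c x + y \<in> ?T"
      using calculation by (simp add: tensor_space_def F.span_add)
    ultimately show ?case using step.IH lin(1,2)[of "fscale c x" y] lin(3,4)[of x x c]
      unfolding tensor_space_def by (simp add: plus_fun_def)
  qed
  then show ?thesis by simp
qed

lemma pure_multilinear: "multilinear_on sc Vs (pure_tensor sc)"
  unfolding multilinear_on_def linear_on_def
  by (auto simp: pure_tensor_def multilinear_form_def fun_eq_iff fscale_def upd_conv_take_nth_drop listset_iff)

lemma tensor_mult_pure:
  "tensor_mult sc (pure_tensor sc us) (pure_tensor sc vs) = pure_tensor sc (us @ vs)"
proof -
  have "multilinear_form sc (\<lambda>ys. \<beta> (xs @ ys))" if "multilinear_form sc \<beta>" for \<beta> xs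
    using that unfolding multilinear_form_def by (metis append.assoc)
  moreover have "multilinear_form sc (\<lambda>xs. \<beta> (xs @ vs))" if "multilinear_form sc \<beta>" for \<beta>
    using that unfolding multilinear_form_def by simp
  ultimately show ?thesis by (auto simp: tensor_mult_def pure_tensor_def fun_eq_iff)
qed

text \<open>
  \<open>id \<otimes> \<rho> \<otimes> id\<close> with \<open>\<rho>\<close> in position \<open>i\<close> (counted from 0). Here \<open>\<rho>\<close> takes values in tensors
  of any length; in particular a linear form \<open>\<epsilon>\<close> is applied as \<open>v \<mapsto> \<epsilon>(v)\<cdot>[]\<close>, the empty word being
  the unit of \<^const>\<open>tensor_mult\<close>.
\<close>

definition apply_at ::
  "('k::field \<Rightarrow> 'v::ab_group_add \<Rightarrow> 'v) \<Rightarrow> 'v set list \<Rightarrow> nat \<Rightarrow> ('v \<Rightarrow> ('v, 'k) tensor) \<Rightarrow>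
   ('v, 'k) tensor \<Rightarrow> ('v, 'k) tensor" where
  "apply_at sc Vs i \<rho> = tensor_lift sc Vs
     (\<lambda>ws. tensor_mult sc (tensor_mult sc (pure_tensor sc (take i ws)) (\<rho> (ws ! i)))
                          (pure_tensor sc (drop (Suc i) ws)))"


subsection \<open>Coalgebras\<close>

record ('k, 'v) coalg =
  carr :: "'v set"
  scal :: "'k \<Rightarrow> 'v \<Rightarrow> 'v"
  comult :: "'v \<Rightarrow> ('v, 'k) tensor"
  counit :: "'v \<Rightarrow> 'k"

definition coalgebra :: "('k::field, 'v::ab_group_add) coalg \<Rightarrow> bool" where
  "coalgebra C \<longleftrightarrow>
     vector_space (scal C) \<and> module.subspace (scal C) (carr C) \<and>
     comult C ` carr C \<subseteq> tensor_space (scal C) [carr C, carr C] \<and>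
     linear_on (scal C) fscale (carr C) (comult C) \<and>
     linear_on (scal C) (*) (carr C) (counit C) \<and>
     (\<forall>c\<in>carr C.
        apply_at (scal C) [carr C, carr C] 0 (comult C) (comult C c) =
        apply_at (scal C) [carr C, carr C] 1 (comult C) (comult C c)) \<and>
     (\<forall>c\<in>carr C. \<forall>i\<in>{0, 1}.
        apply_at (scal C) [carr C, carr C] i
          (\<lambda>v. fscale (counit C v) (pure_tensor (scal C) [])) (comult C c) =
        pure_tensor (scal C) [c])"

definition coalgebra_iso ::
  "('k::field, 'v::ab_group_add) coalg \<Rightarrow> ('k, 'w::ab_group_add) coalg \<Rightarrow> ('v \<Rightarrow> 'w) \<Rightarrow> bool" where
  "coalgebra_iso C E h \<longleftrightarrow>
     coalgebra C \<and> coalgebra E \<and>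
     bij_betw h (carr C) (carr E) \<and> linear_on (scal C) (scal E) (carr C) h \<and>
     (\<forall>c\<in>carr C. comult E (h c) =
        tensor_lift (scal C) [carr C, carr C] (\<lambda>ws. pure_tensor (scal E) (map h ws)) (comult C c)) \<and>
     (\<forall>c\<in>carr C. counit E (h c) = counit C c)"

definition coalgebras_isomorphic ::
  "('k::field, 'v::ab_group_add) coalg \<Rightarrow> ('k, 'w::ab_group_add) coalg \<Rightarrow> bool" where
  "coalgebras_isomorphic C E \<longleftrightarrow> (\<exists>h. coalgebra_iso C E h)"


subsection \<open>Algebras and their dual coalgebras\<close>

definition algebra_scale :: "('k::field \<Rightarrow> 'a::ring_1 \<Rightarrow> 'a) \<Rightarrow> bool" where
  "algebra_scale sA \<longleftrightarrow> vector_space sA \<and>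
     (\<forall>c x y. sA c (x * y) = sA c x * y \<and> sA c (x * y) = x * sA c y)"

definition linear_dual :: "('k::field \<Rightarrow> 'a::ring_1 \<Rightarrow> 'a) \<Rightarrow> ('a \<Rightarrow> 'k) set" where
  "linear_dual sA = {f. Vector_Spaces.linear sA (*) f}"

definition two_sided_ideal :: "'a::ring_1 set \<Rightarrow> bool" where
  "two_sided_ideal I \<longleftrightarrow> 0 \<in> I \<and> (\<forall>x\<in>I. \<forall>y\<in>I. x + y \<in> I) \<and> (\<forall>a. \<forall>x\<in>I. a * x \<in> I \<and> x * a \<in> I)"

definition finite_codim :: "('k::field \<Rightarrow> 'a::ab_group_add \<Rightarrow> 'a) \<Rightarrow> 'a set \<Rightarrow> bool" where
  "finite_codim sA I \<longleftrightarrow> (\<exists>S. finite S \<and> module.span sA (S \<union> I) = UNIV)"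

definition finite_dual :: "('k::field \<Rightarrow> 'a::ring_1 \<Rightarrow> 'a) \<Rightarrow> ('a \<Rightarrow> 'k) set" where
  "finite_dual sA = {f \<in> linear_dual sA.
     \<exists>I. two_sided_ideal I \<and> finite_codim sA I \<and> (\<forall>x\<in>I. f x = 0)}"

text \<open>
  The coalgebra structure dual to multiplication and unit on a space \<open>V\<close> of linear forms on an
  algebra: \<open>\<Delta>(f) = \<Sum> f\<^sub>i \<otimes> g\<^sub>i\<close> is the tensor in \<open>V \<otimes> V\<close> with \<open>f (a * b) = \<Sum> f\<^sub>i a * g\<^sub>i b\<close>,
  and \<open>\<epsilon>(f) = f 1\<close>. The form being evaluated is
  \<open>(g, h) \<mapsto> g a * h b\<close>, extended by 0 to words of other lengths.
\<close>

definition dual_coalg_on :: "('a::ring_1 \<Rightarrow> 'k::field) set \<Rightarrow> ('k, 'a \<Rightarrow> 'k) coalg" where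
  "dual_coalg_on V = \<lparr>
     carr = V,
     scal = fscale,
     comult = (\<lambda>f. THE t. t \<in> tensor_space fscale [V, V] \<and>
       (\<forall>a b. t (\<lambda>ws. case ws of [g, h] \<Rightarrow> g a * h b | _ \<Rightarrow> 0) = f (a * b))),
     counit = (\<lambda>f. f 1)\<rparr>"

definition dual_coalg :: "('k::field \<Rightarrow> 'a::ring_1 \<Rightarrow> 'a) \<Rightarrow> ('k, 'a \<Rightarrow> 'k) coalg" where
  "dual_coalg sA = dual_coalg_on (linear_dual sA)"

definition finite_dual_coalg :: "('k::field \<Rightarrow> 'a::ring_1 \<Rightarrow> 'a) \<Rightarrow> ('k, 'a \<Rightarrow> 'k) coalg" where
  "finite_dual_coalg sA = dual_coalg_on (finite_dual sA)"

definition fps_scale :: "('k \<Rightarrow> 'd \<Rightarrow> 'd) \<Rightarrow> 'k \<Rightarrow> 'd::zero fps \<Rightarrow> 'd fps" where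
  "fps_scale sD c f = Abs_fps (\<lambda>n. sD c (fps_nth f n))"


subsection \<open>The cotensor coalgebra\<close>

text \<open>
  For a coalgebra \<open>C\<close> and a \<open>C\<close>-bicomodule \<open>N\<close> with coactions \<open>\<rho>l : N \<rightarrow> C \<otimes> N\<close> and
  \<open>\<rho>r : N \<rightarrow> N \<otimes> C\<close> (both inside the same ambient space), the \<open>n\<close>-fold cotensor product consists
  of the tensors in \<open>N \<otimes> \<dots> \<otimes> N\<close> on which \<open>\<rho>r\<close> in each factor agrees with \<open>\<rho>l\<close> in the next one.
  The summands \<open>C\<close> and \<open>N\<close> in degrees 0 and 1 are represented by words of length one.
\<close>

definition cotensor_power ::
  "('k::field, 'v::ab_group_add) coalg \<Rightarrow> 'v set \<Rightarrow> ('v \<Rightarrow> ('v, 'k) tensor) \<Rightarrow>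
   ('v \<Rightarrow> ('v, 'k) tensor) \<Rightarrow> nat \<Rightarrow> ('v, 'k) tensor set" where
  "cotensor_power C N \<rho>l \<rho>r n =
     (if n = 0 then tensor_space (scal C) [carr C]
      else {t \<in> tensor_space (scal C) (replicate n N). \<forall>i. Suc i < n \<longrightarrow>
              apply_at (scal C) (replicate n N) i \<rho>r t =
              apply_at (scal C) (replicate n N) (Suc i) \<rho>l t})"

definition dsum_scale :: "'k::field \<Rightarrow> (nat \<Rightarrow> ('v, 'k) tensor) \<Rightarrow> nat \<Rightarrow> ('v, 'k) tensor" where
  "dsum_scale c F = (\<lambda>n. fscale c (F n))"

definition dsum_in :: "nat \<Rightarrow> ('v, 'k::field) tensor \<Rightarrow> nat \<Rightarrow> ('v, 'k) tensor" where
  "dsum_in n t = (\<lambda>m. if m = n then t else 0)"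

text \<open>
  Cuts each word after \<open>j\<close> letters and places the pieces in degrees \<open>p\<close> and \<open>q\<close> of the direct sum.
\<close>

definition tensor_split ::
  "('k::field \<Rightarrow> 'v::ab_group_add \<Rightarrow> 'v) \<Rightarrow> 'v set list \<Rightarrow> nat \<Rightarrow> nat \<Rightarrow> nat \<Rightarrow>
   ('v, 'k) tensor \<Rightarrow> (nat \<Rightarrow> ('v, 'k) tensor, 'k) tensor" where
  "tensor_split sc Vs j p q = tensor_lift sc Vs (\<lambda>ws. pure_tensor dsum_scale
     [dsum_in p (pure_tensor sc (take j ws)), dsum_in q (pure_tensor sc (drop j ws))])"

definition cotensor_comult_hom ::
  "('k::field, 'v::ab_group_add) coalg \<Rightarrow> 'v set \<Rightarrow> ('v \<Rightarrow> ('v, 'k) tensor) \<Rightarrow>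
   ('v \<Rightarrow> ('v, 'k) tensor) \<Rightarrow> nat \<Rightarrow> ('v, 'k) tensor \<Rightarrow> (nat \<Rightarrow> ('v, 'k) tensor, 'k) tensor" where
  "cotensor_comult_hom C N \<rho>l \<rho>r n t =
     (let sc = scal C; Ns = replicate n N in
      if n = 0 then
        tensor_split sc [carr C, carr C] 1 0 0 (apply_at sc [carr C] 0 (comult C) t)
      else
        tensor_split sc (carr C # Ns) 1 0 n (apply_at sc Ns 0 \<rho>l t)
        + (\<Sum>i = 1..<n. tensor_split sc Ns i i (n - i) t)
        + tensor_split sc (Ns @ [carr C]) n n 0 (apply_at sc Ns (n - 1) \<rho>r t))"

definition cotensor_coalg ::
  "('k::field, 'v::ab_group_add) coalg \<Rightarrow> 'v set \<Rightarrow> ('v \<Rightarrow> ('v, 'k) tensor) \<Rightarrow>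
   ('v \<Rightarrow> ('v, 'k) tensor) \<Rightarrow> ('k, nat \<Rightarrow> ('v, 'k) tensor) coalg" where
  "cotensor_coalg C N \<rho>l \<rho>r = \<lparr>
     carr = {F. finite {n. F n \<noteq> 0} \<and> (\<forall>n. F n \<in> cotensor_power C N \<rho>l \<rho>r n)},
     scal = dsum_scale,
     comult = (\<lambda>F. \<Sum>n | F n \<noteq> 0. cotensor_comult_hom C N \<rho>l \<rho>r n (F n)),
     counit = (\<lambda>F. counit C (THE c. c \<in> carr C \<and> F 0 = pure_tensor (scal C) [c]))\<rparr>"

text \<open>
  The coalgebra \<open>\<D>\<C>(D, id)\<close>: the bicomodule is \<open>D\<^sup>*\<close>, both coactions being the comultiplication.
\<close>

definition DC_id ::
  "('k::field \<Rightarrow> 'd::ring_1 \<Rightarrow> 'd) \<Rightarrow> ('k, nat \<Rightarrow> ('d \<Rightarrow> 'k, 'k) tensor) coalg" where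
  "DC_id sD = (let C = dual_coalg sD in cotensor_coalg C (carr C) (comult C) (comult C))"

end

theory Submission
  imports Defs
begin

text \<open>
  The idea is that both coalgebras are the same coalgebra of functions on one monoid, namely the
  monoid of homogeneous elements \<open>a * x^n\<close> of \<open>D[[x]]\<close> with \<open>a\<close> in \<open>D\<close>.

  On the side of the finite dual: as \<open>D\<close> is a division ring, every nonzero ideal of \<open>D[[x]]\<close>
  contains a power of \<open>x\<close>, and the zero ideal has infinite codimension. Hence the finite dual
  consists of the linear forms that vanish on all series of high order (finite_dual_eq). Such a form
  is determined by its values at the elements \<open>a * x^n\<close>, and its comultiplication is
  \<open>f \<mapsto> ((u, v) \<mapsto> f (u * v))\<close>.

  On the side of the cotensor coalgebra: a tensor in the \<open>n\<close>-fold tensor power of the dual of \<open>D\<close>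
  is a multilinear function of \<open>n\<close> elements of \<open>D\<close>. The cotensor condition says that a factor may be
  moved from one argument to the next, hence that the function depends on the product of the
  arguments only (cotensor_power_iff). So every cotensor power is a copy of the dual of \<open>D\<close>, the
  \<open>n\<close>-th one being regarded as functions of \<open>a * x^n\<close>. Cutting the word of letters in two, as the
  comultiplication does in all ways including the two extreme ones, evaluates a function at the
  product of what the two parts are evaluated at; the cut with pieces of lengths \<open>p\<close> and \<open>q\<close>
  accounts for the arguments \<open>a * x^p\<close> and \<open>b * x^q\<close> (comult_hom, DC_comult_word_eval).

  What makes this a proof is that evaluations separating the elements of a space also separate its
  tensors (eval_separates_tensors): all identities between tensors may be checked on products of
  evaluations. Coassociativity and the counit laws become the monoid laws
  (represented_is_coalgebra), and a bijection preserving the values at the elements of the monoid is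
  an isomorphism of coalgebras (represented_coalgebra_iso).

  One point is not formal. The formula for the comultiplication of the cotensor coalgebra is a sum
  of tensors of words that individually do not lie in cotensor powers. That the sum lies in the
  tensor square of the cotensor coalgebra is obtained by transporting the comultiplication of the
  finite dual along the bijection and comparing the two on all words (DC_comult_hom_eval).
\<close>

section \<open>Tensors as functionals on multilinear forms\<close>

interpretation fs: vector_space "fscale :: 'k::field \<Rightarrow> ('y \<Rightarrow> 'k) \<Rightarrow> 'y \<Rightarrow> 'k"
  by (rule vector_space_fscale)

lemma fscale_apply: "fscale c f y = c * f y"
  by (simp add: fscale_def)

text \<open>
  Zero, sums and multiples of functions are kept folded by default, so that rules about functions
  as vectors remain applicable.
\<close>

declare plus_fun_apply [simp del] zero_fun_apply [simp del]

lemmas pointwise = plus_fun_apply zero_fun_apply fscale_apply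

lemma multilinear_form_add:
  "multilinear_form sc \<beta> \<Longrightarrow> \<beta> (us @ (x + y) # vs) = \<beta> (us @ x # vs) + \<beta> (us @ y # vs)"
  by (simp add: multilinear_form_def)

lemma multilinear_form_scale:
  "multilinear_form sc \<beta> \<Longrightarrow> \<beta> (us @ sc c x # vs) = c * \<beta> (us @ x # vs)"
  by (simp add: multilinear_form_def)

lemma multilinear_form_context:
  assumes "multilinear_form sc \<beta>"
  shows "multilinear_form sc (\<lambda>ys. \<beta> (us @ ys @ vs))"
  unfolding multilinear_form_def
proof (intro conjI allI)
  fix us' vs' x y c
  show "\<beta> (us @ (us' @ (x + y) # vs') @ vs) = \<beta> (us @ (us' @ x # vs') @ vs) + \<beta> (us @ (us' @ y # vs') @ vs)"
    using multilinear_form_add[OF assms, of "us @ us'" x y "vs' @ vs"] by simp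
  show "\<beta> (us @ (us' @ sc c x # vs') @ vs) = c * \<beta> (us @ (us' @ x # vs') @ vs)"
    using multilinear_form_scale[OF assms, of "us @ us'" c x "vs' @ vs"] by simp
qed

lemma multilinear_form_plus:
  "multilinear_form sc \<beta> \<Longrightarrow> multilinear_form sc \<gamma> \<Longrightarrow> multilinear_form sc (\<lambda>ws. \<beta> ws + \<gamma> ws)"
  unfolding multilinear_form_def by (auto simp: algebra_simps)

lemma multilinear_form_times:
  "multilinear_form sc \<beta> \<Longrightarrow> multilinear_form sc (\<lambda>ws. c * \<beta> ws)"
  unfolding multilinear_form_def by (auto simp: algebra_simps)

lemma sum_fun_apply: "(\<Sum>i\<in>T. F i) x = (\<Sum>i\<in>T. F i x)"
  by (induction T rule: infinite_finite_induct) (simp_all add: pointwise)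

lemma pure_tensor_add:
  "pure_tensor sc (us @ (x + y) # vs) = pure_tensor sc (us @ x # vs) + pure_tensor sc (us @ y # vs)"
  by (auto simp: fun_eq_iff pointwise pure_tensor_def multilinear_form_add)

lemma pure_tensor_times:
  "pure_tensor sc (us @ sc c x # vs) = fscale c (pure_tensor sc (us @ x # vs))"
  by (auto simp: fun_eq_iff pointwise pure_tensor_def multilinear_form_scale)

lemma tensor_space_induct [consumes 1, case_names zero step]:
  assumes "t \<in> tensor_space sc Vs" and "P 0"
    and "\<And>c ws t. ws \<in> listset Vs \<Longrightarrow> t \<in> tensor_space sc Vs \<Longrightarrow> P t \<Longrightarrow>
      P (fscale c (pure_tensor sc ws) + t)"
  shows "P t"
proof -
  have "t \<in> tensor_space sc Vs \<and> P t"
    using assms(1) unfolding tensor_space_def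
  proof (induction rule: fs.span_induct_alt)
    case base
    show ?case using assms(2) by (simp add: fs.span_zero)
  next
    case (step c x y)
    then obtain ws where "ws \<in> listset Vs" "x = pure_tensor sc ws" by auto
    with step assms(3) show ?case
      by (auto simp: tensor_space_def intro: fs.span_add fs.span_scale fs.span_base)
  qed
  then show ?thesis by simp
qed

lemma subspace_tensor_space: "fs.subspace (tensor_space sc Vs)"
  by (simp add: tensor_space_def)

lemma pure_in_tensor_space: "ws \<in> listset Vs \<Longrightarrow> pure_tensor sc ws \<in> tensor_space sc Vs"
  by (simp add: tensor_space_def fs.span_base)

lemma tensor_space_mono:
  assumes "listset Vs \<subseteq> listset Ws"
  shows "tensor_space sc Vs \<subseteq> tensor_space sc Ws"
  unfolding tensor_space_def by (intro fs.span_mono image_mono assms)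

text \<open>
  A tensor is a combination of evaluations at words, so it depends linearly on the form and sees it
  only on the words of the tensor space.
\<close>

lemma tensor_form_add:
  assumes "t \<in> tensor_space sc Vs" "multilinear_form sc \<beta>" "multilinear_form sc \<gamma>"
  shows "t (\<lambda>ws. \<beta> ws + \<gamma> ws) = t \<beta> + t \<gamma>"
  using assms(1)
  by (induction rule: tensor_space_induct)
     (simp_all add: assms(2,3) multilinear_form_plus pointwise pure_tensor_def algebra_simps)

lemma tensor_form_times:
  assumes "t \<in> tensor_space sc Vs" "multilinear_form sc \<beta>"
  shows "t (\<lambda>ws. c * \<beta> ws) = c * t \<beta>"
  using assms(1)
  by (induction rule: tensor_space_induct)
     (simp_all add: assms(2) multilinear_form_times pointwise pure_tensor_def algebra_simps)

lemma tensor_form_cong: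
  assumes "t \<in> tensor_space sc Vs" "multilinear_form sc \<beta>" "multilinear_form sc \<gamma>"
    and "\<And>ws. ws \<in> listset Vs \<Longrightarrow> \<beta> ws = \<gamma> ws"
  shows "t \<beta> = t \<gamma>"
  using assms(1)
  by (induction rule: tensor_space_induct) (simp_all add: assms(2-) pointwise pure_tensor_def)

lemma multilinear_onI:
  assumes "\<And>us x y vs. us @ x # vs \<in> listset Vs \<Longrightarrow> us @ y # vs \<in> listset Vs \<Longrightarrow>
      \<phi> (us @ (x + y) # vs) = \<phi> (us @ x # vs) + \<phi> (us @ y # vs)"
    and "\<And>us x c vs. us @ x # vs \<in> listset Vs \<Longrightarrow>
      \<phi> (us @ sc c x # vs) = fscale c (\<phi> (us @ x # vs))"
  shows "multilinear_on sc Vs \<phi>"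
  unfolding multilinear_on_def linear_on_def
proof (intro allI impI ballI conjI)
  fix i ws x y c
  assume i: "i < length Vs" and ws: "ws \<in> listset Vs" and x: "x \<in> Vs ! i"
  have upd: "ws[i := z] = take i ws @ z # drop (Suc i) ws" for z
    using i ws by (simp add: upd_conv_take_nth_drop listset_iff)
  have mem: "take i ws @ z # drop (Suc i) ws \<in> listset Vs" if "z \<in> Vs ! i" for z
    unfolding upd[symmetric] using i ws that by (auto simp: listset_iff nth_list_update)
  show "\<phi> (ws[i := sc c x]) = fscale c (\<phi> (ws[i := x]))"
    unfolding upd using assms(2) mem x by blast
  assume y: "y \<in> Vs ! i"
  show "\<phi> (ws[i := x + y]) = \<phi> (ws[i := x]) + \<phi> (ws[i := y])"
    unfolding upd using assms(1) mem x y by blast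
qed

context
  fixes sc :: "'k::field \<Rightarrow> 'v::ab_group_add \<Rightarrow> 'v" and Vs :: "'v set list"
    and \<phi> :: "'v list \<Rightarrow> 'y \<Rightarrow> 'k"
  assumes vs: "vector_space sc" and sub: "\<forall>V\<in>set Vs. module.subspace sc V"
    and ml: "multilinear_on sc Vs \<phi>"
begin

lemma tensor_lift_zero: "tensor_lift sc Vs \<phi> 0 = 0"
proof -
  have "0 \<in> tensor_space sc Vs" using subspace_tensor_space fs.subspace_0 by blast
  then have "tensor_lift sc Vs \<phi> (fscale 0 0) = fscale 0 (tensor_lift sc Vs \<phi> 0)"
    using tensor_lift_universal(1)[OF vs bspec[OF sub] ml] unfolding linear_on_def by blast
  then show ?thesis by simp
qed

lemma tensor_lift_step:
  assumes "ws \<in> listset Vs" "t \<in> tensor_space sc Vs"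
  shows "tensor_lift sc Vs \<phi> (fscale c (pure_tensor sc ws) + t) = fscale c (\<phi> ws) + tensor_lift sc Vs \<phi> t"
proof -
  have "pure_tensor sc ws \<in> tensor_space sc Vs" "fscale c (pure_tensor sc ws) \<in> tensor_space sc Vs"
    using assms(1) by (auto intro!: pure_in_tensor_space fs.subspace_scale subspace_tensor_space)
  then show ?thesis
    using tensor_lift_universal[OF vs bspec[OF sub] ml] assms unfolding linear_on_def by simp
qed

lemma tensor_lift_eval:
  assumes "multilinear_form sc \<gamma>" "\<And>ws. ws \<in> listset Vs \<Longrightarrow> \<phi> ws y = \<gamma> ws"
    and "t \<in> tensor_space sc Vs"
  shows "tensor_lift sc Vs \<phi> t y = t \<gamma>"
  using assms(3)
  by (induction rule: tensor_space_induct)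
     (simp_all only: tensor_lift_zero tensor_lift_step, simp_all add: assms(1,2) pointwise pure_tensor_def)

lemma tensor_lift_in_subspace:
  assumes "fs.subspace W" "\<And>ws. ws \<in> listset Vs \<Longrightarrow> \<phi> ws \<in> W"
    and "t \<in> tensor_space sc Vs"
  shows "tensor_lift sc Vs \<phi> t \<in> W"
  using assms(3)
  by (induction rule: tensor_space_induct)
     (auto simp: tensor_lift_zero tensor_lift_step assms
       intro!: fs.subspace_0 fs.subspace_add fs.subspace_scale)

end

subsection \<open>Applying a map in one tensor factor\<close>

text \<open>
  Elements of a tensor space send multilinear families of forms to multilinear forms, so the guards
  in \<^const>\<open>tensor_mult\<close> and \<^const>\<open>pure_tensor\<close> are satisfied and a product with \<open>r\<close> in the middle
  is \<open>r\<close> applied to the form with the outer letters filled in.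
\<close>

lemma tensor_mult_context:
  assumes "r \<in> tensor_space sc Us"
  shows "tensor_mult sc (tensor_mult sc (pure_tensor sc us) r) (pure_tensor sc vs) =
    (\<lambda>\<beta>. if multilinear_form sc \<beta> then r (\<lambda>ys. \<beta> (us @ ys @ vs)) else 0)"
proof
  fix \<beta>
  show "tensor_mult sc (tensor_mult sc (pure_tensor sc us) r) (pure_tensor sc vs) \<beta> =
    (if multilinear_form sc \<beta> then r (\<lambda>ys. \<beta> (us @ ys @ vs)) else 0)"
  proof (cases "multilinear_form sc \<beta>")
    case True
    have 1: "multilinear_form sc (\<lambda>ys. \<beta> (xs @ ys))" for xs
      using multilinear_form_context[OF True, of xs "[]"] by simp
    have 2: "multilinear_form sc (\<lambda>xs. \<beta> (xs @ vs))"
      using multilinear_form_context[OF True, of "[]" vs] by simp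
    have 3: "multilinear_form sc (\<lambda>ys. \<beta> (xs @ ys @ vs))" for xs
      by (rule multilinear_form_context[OF True])
    have "multilinear_form sc (\<lambda>xs. r (\<lambda>ys. \<beta> (xs @ ys @ vs)))"
      unfolding multilinear_form_def
    proof (intro conjI allI)
      fix us' vs' x y c
      show "r (\<lambda>ys. \<beta> ((us' @ (x + y) # vs') @ ys @ vs)) =
        r (\<lambda>ys. \<beta> ((us' @ x # vs') @ ys @ vs)) + r (\<lambda>ys. \<beta> ((us' @ y # vs') @ ys @ vs))"
        using tensor_form_add[OF assms 3 3, of "us' @ x # vs'" "us' @ y # vs'"]
          multilinear_form_add[OF True, of us' x y] by simp
      show "r (\<lambda>ys. \<beta> ((us' @ sc c x # vs') @ ys @ vs)) = c * r (\<lambda>ys. \<beta> ((us' @ x # vs') @ ys @ vs))"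
        using tensor_form_times[OF assms 3, of c "us' @ x # vs'"]
          multilinear_form_scale[OF True, of us' c x] by simp
    qed
    moreover have "multilinear_form sc (\<lambda>zs. \<beta> (xs @ ys @ zs))" for xs ys
      using 1[of "xs @ ys"] by simp
    ultimately show ?thesis
      using True 1 2 by (simp add: tensor_mult_def pure_tensor_def)
  qed (simp add: tensor_mult_def)
qed

lemma listset_split:
  assumes "ws \<in> listset Vs" "i < length Vs"
  shows "ws ! i \<in> Vs ! i" "take i ws \<in> listset (take i Vs)" "drop (Suc i) ws \<in> listset (drop (Suc i) Vs)"
  using assms by (auto simp: listset_iff)

lemma listset_update: "ws \<in> listset Vs \<Longrightarrow> x \<in> Vs ! i \<Longrightarrow> ws[i := x] \<in> listset Vs"
  by (cases "i < length ws") (auto simp: listset_iff nth_list_update)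

lemma listset_append:
  "us \<in> listset Us \<Longrightarrow> vs \<in> listset Vs \<Longrightarrow> us @ vs \<in> listset (Us @ Vs)"
  by (auto simp: listset_iff nth_append)

context
  fixes sc :: "'k::field \<Rightarrow> 'v::ab_group_add \<Rightarrow> 'v" and Vs Us :: "'v set list"
    and \<rho> :: "'v \<Rightarrow> ('v, 'k) tensor" and i :: nat
  assumes vs: "vector_space sc" and sub: "\<forall>V\<in>set Vs. module.subspace sc V"
    and i: "i < length Vs"
    and \<rho>_lin: "linear_on sc fscale (Vs ! i) \<rho>"
    and \<rho>_in: "\<And>x. x \<in> Vs ! i \<Longrightarrow> \<rho> x \<in> tensor_space sc Us"
begin

abbreviation (input) apply_pure :: "'v list \<Rightarrow> ('v, 'k) tensor" where
  "apply_pure ws \<equiv> tensor_mult sc (tensor_mult sc (pure_tensor sc (take i ws)) (\<rho> (ws ! i)))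
                          (pure_tensor sc (drop (Suc i) ws))"

lemma apply_pure_eq:
  assumes "ws \<in> listset Vs"
  shows "apply_pure ws = (\<lambda>\<beta>. if multilinear_form sc \<beta>
     then \<rho> (ws ! i) (\<lambda>ys. \<beta> (take i ws @ ys @ drop (Suc i) ws)) else 0)"
  using assms i by (intro tensor_mult_context[of _ _ Us] \<rho>_in listset_split)

lemma multilinear_apply_pure: "multilinear_on sc Vs apply_pure"
proof (rule multilinear_onI)
  interpret vs: vector_space sc by (rule vs)
  fix us x ws
  assume x: "us @ x # ws \<in> listset Vs"
  have len: "length us < length Vs" using x by (auto simp: listset_iff)
  have xV: "z \<in> Vs ! length us" if "us @ z # ws \<in> listset Vs" for z
    using listset_split(1)[OF that len] by simp
  have mem: "us @ z # ws \<in> listset Vs" if "z \<in> Vs ! length us" for z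
    using listset_update[OF x that] by simp
  have subV: "vs.subspace (Vs ! length us)" using sub len by simp
  have split: "apply_pure (us @ z # ws) \<beta> =
      (if length us < i then
         \<rho> (ws ! (i - length us - 1)) (\<lambda>ys. \<beta> (us @ z # (take (i - length us - 1) ws @ ys @ drop (i - length us) ws)))
       else if length us = i then \<rho> z (\<lambda>ys. \<beta> (us @ ys @ ws))
       else \<rho> (us ! i) (\<lambda>ys. \<beta> ((take i us @ ys @ drop (Suc i) us) @ z # ws)))"
    if "us @ z # ws \<in> listset Vs" "multilinear_form sc \<beta>" for z \<beta>
  proof -
    consider (lt) k where "i = length us + Suc k" | "i = length us" | "i < length us"
      by (metis add_Suc_right less_imp_Suc_add linorder_neqE_nat)
    then show ?thesis
      unfolding apply_pure_eq[OF that(1)] using that(2) by cases (simp_all add: nth_append)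
  qed
  have \<rho>1: "\<rho> (ws ! (i - length us - 1)) \<in> tensor_space sc Us" if "length us < i"
    using \<rho>_in[OF listset_split(1)[OF x i]] that by (simp add: nth_append)
  have \<rho>2: "\<rho> (us ! i) \<in> tensor_space sc Us" if "i < length us"
    using \<rho>_in[OF listset_split(1)[OF x i]] that by (simp add: nth_append)
  have form1: "multilinear_form sc (\<lambda>ys. \<beta> (us @ z # (vs1 @ ys @ vs2)))"
    if "multilinear_form sc \<beta>" for \<beta> z vs1 vs2
    using multilinear_form_context[OF that, of "us @ z # vs1" vs2] by simp
  have form2: "multilinear_form sc (\<lambda>ys. \<beta> ((us1 @ ys @ us2) @ z # ws))"
    if "multilinear_form sc \<beta>" for \<beta> z us1 us2
    using multilinear_form_context[OF that, of us1 "us2 @ z # ws"] by simp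
  have not_form: "apply_pure vs' \<beta> = 0" if "\<not> multilinear_form sc \<beta>" for vs' \<beta>
    using that by (simp add: tensor_mult_def)
  {
    fix y assume y: "us @ y # ws \<in> listset Vs"
    have xy: "us @ (x + y) # ws \<in> listset Vs"
      using vs.subspace_add[OF subV xV[OF x] xV[OF y]] by (rule mem)
    show "apply_pure (us @ (x + y) # ws) = apply_pure (us @ x # ws) + apply_pure (us @ y # ws)"
    proof
      fix \<beta>
      show "apply_pure (us @ (x + y) # ws) \<beta> = (apply_pure (us @ x # ws) + apply_pure (us @ y # ws)) \<beta>"
      proof (cases "multilinear_form sc \<beta>")
        case True
        note split_all = plus_fun_apply split[OF xy True] split[OF x True] split[OF y True]
          multilinear_form_add[OF True]
        consider (lt) "length us < i" | (eq) "length us = i" "\<not> length us < i"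
          | (gt) "i < length us" "length us \<noteq> i" "\<not> length us < i" by linarith
        then show ?thesis
        proof cases
          case lt
          show ?thesis
            by (simp only: split_all lt if_True tensor_form_add[OF \<rho>1[OF lt] form1[OF True] form1[OF True]])
        next
          case eq
          have "\<rho> (x + y) = \<rho> x + \<rho> y"
            using \<rho>_lin xV[OF x] xV[OF y] eq by (simp add: linear_on_def)
          then show ?thesis
            by (simp only: split_all eq order.irrefl simp_thms if_False if_True)
        next
          case gt
          show ?thesis
            by (simp only: split_all gt if_False tensor_form_add[OF \<rho>2[OF gt(1)] form2[OF True] form2[OF True]])
        qed
      qed (simp only: plus_fun_apply not_form add_0_left simp_thms)
    qed
  }
  fix c
  have cx: "us @ sc c x # ws \<in> listset Vs"
    using vs.subspace_scale[OF subV xV[OF x]] by (rule mem)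
  show "apply_pure (us @ sc c x # ws) = fscale c (apply_pure (us @ x # ws))"
  proof
    fix \<beta>
    show "apply_pure (us @ sc c x # ws) \<beta> = fscale c (apply_pure (us @ x # ws)) \<beta>"
    proof (cases "multilinear_form sc \<beta>")
      case True
      note split_all = fscale_apply split[OF cx True] split[OF x True] multilinear_form_scale[OF True]
      consider (lt) "length us < i" | (eq) "length us = i" "\<not> length us < i"
        | (gt) "i < length us" "length us \<noteq> i" "\<not> length us < i" by linarith
      then show ?thesis
      proof cases
        case lt
        show ?thesis
          by (simp only: split_all lt if_True tensor_form_times[OF \<rho>1[OF lt] form1[OF True]])
      next
        case eq
        have "\<rho> (sc c x) = fscale c (\<rho> x)"
          using \<rho>_lin xV[OF x] eq by (simp add: linear_on_def)
        then show ?thesis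
          by (simp only: split_all eq order.irrefl simp_thms if_False if_True)
      next
        case gt
        show ?thesis
          by (simp only: split_all gt if_False tensor_form_times[OF \<rho>2[OF gt(1)] form2[OF True]])
      qed
    qed (simp only: fscale_apply not_form mult_zero_right simp_thms)
  qed
qed

text \<open>
  In the following rule \<open>\<gamma>\<close> is given separately, since the form on the right of its last premise
  need not be multilinear on words outside the tensor space, where \<open>\<rho>\<close> is arbitrary.
\<close>

lemma apply_at_form:
  assumes "t \<in> tensor_space sc Vs" "multilinear_form sc \<beta>" "multilinear_form sc \<gamma>"
    and "\<And>ws. ws \<in> listset Vs \<Longrightarrow>
      \<gamma> ws = \<rho> (ws ! i) (\<lambda>ys. \<beta> (take i ws @ ys @ drop (Suc i) ws))"
  shows "apply_at sc Vs i \<rho> t \<beta> = t \<gamma>"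
proof -
  have "apply_pure ws \<beta> = \<gamma> ws" if "ws \<in> listset Vs" for ws
    by (simp only: apply_pure_eq[OF that] assms(2) assms(4)[OF that] if_True)
  then show ?thesis
    unfolding apply_at_def
    by (rule tensor_lift_eval[OF vs sub multilinear_apply_pure assms(3) _ assms(1)])
qed

lemma apply_at_in:
  assumes "t \<in> tensor_space sc Vs"
  shows "apply_at sc Vs i \<rho> t \<in> tensor_space sc (take i Vs @ Us @ drop (Suc i) Vs)"
  unfolding apply_at_def
proof (rule tensor_lift_in_subspace[OF vs sub multilinear_apply_pure subspace_tensor_space _ assms])
  fix ws assume ws: "ws \<in> listset Vs"
  have "tensor_mult sc (tensor_mult sc (pure_tensor sc us) r) (pure_tensor sc ws')
      \<in> tensor_space sc (take i Vs @ Us @ drop (Suc i) Vs)"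
    if r: "r \<in> tensor_space sc Us" and us: "us \<in> listset (take i Vs)"
      and ws': "ws' \<in> listset (drop (Suc i) Vs)" for r us ws'
    using r
  proof (induction rule: tensor_space_induct)
    case zero
    have "tensor_mult sc (tensor_mult sc (pure_tensor sc us) 0) (pure_tensor sc ws') = 0"
      by (simp add: tensor_mult_def pure_tensor_def pointwise fun_eq_iff)
    then show ?case by (simp add: fs.subspace_0 subspace_tensor_space)
  next
    case (step c vs r)
    have "fscale c (pure_tensor sc vs) + r \<in> tensor_space sc Us"
      using step by (intro fs.subspace_add fs.subspace_scale subspace_tensor_space pure_in_tensor_space)
    then have "tensor_mult sc (tensor_mult sc (pure_tensor sc us) (fscale c (pure_tensor sc vs) + r)) (pure_tensor sc ws')
      = fscale c (pure_tensor sc (us @ vs @ ws'))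
        + tensor_mult sc (tensor_mult sc (pure_tensor sc us) r) (pure_tensor sc ws')"
      using step by (simp add: tensor_mult_context[of _ sc Us] pointwise fun_eq_iff)
        (simp add: pure_tensor_def multilinear_form_context)
    then show ?case
      using step us ws' by (simp add: fs.subspace_add fs.subspace_scale subspace_tensor_space
          pure_in_tensor_space listset_append)
  qed
  then show "apply_pure ws \<in> tensor_space sc (take i Vs @ Us @ drop (Suc i) Vs)"
    using listset_split[OF ws i] \<rho>_in by blast
qed

end

section \<open>Separating tensors by evaluations\<close>

text \<open>
  The product of evaluations letter by letter. Being 0 on words of any other length, it tests one
  tensor power only.
\<close>

fun eval_form :: "('i \<Rightarrow> 'v \<Rightarrow> 'k::field) \<Rightarrow> 'i list \<Rightarrow> 'v list \<Rightarrow> 'k" where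
  "eval_form e [] [] = 1"
| "eval_form e (k # ks) (v # vs) = e k v * eval_form e ks vs"
| "eval_form e _ _ = 0"

lemma eval_form_append:
  "eval_form e (ks @ ls) ws = eval_form e ks (take (length ks) ws) * eval_form e ls (drop (length ks) ws)"
proof (induction ks arbitrary: ws)
  case (Cons k ks)
  then show ?case by (cases ws) auto
qed simp

lemma eval_form_length: "length ks \<noteq> length ws \<Longrightarrow> eval_form e ks ws = 0"
  by (induction e ks ws rule: eval_form.induct) auto

lemma multilinear_eval_form:
  assumes "\<And>k x y. k \<in> set ks \<Longrightarrow> e k (x + y) = e k x + e k y"
    and "\<And>k c x. k \<in> set ks \<Longrightarrow> e k (sc c x) = c * e k x"
  shows "multilinear_form sc (eval_form e ks)"
proof -
  have "eval_form e ks (us @ (x + y) # vs) = eval_form e ks (us @ x # vs) + eval_form e ks (us @ y # vs)"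
    and "eval_form e ks (us @ sc c x # vs) = c * eval_form e ks (us @ x # vs)" for us vs x y c
    using assms
  proof (induction ks arbitrary: us)
    case (Cons k ks)
    { case 1 with Cons show ?case by (cases us) (auto simp: algebra_simps) }
    { case 2 with Cons show ?case by (cases us) (auto simp: algebra_simps) }
  qed (simp_all add: eval_form_length)
  then show ?thesis by (auto simp: multilinear_form_def)
qed

text \<open>
  The evaluations are linear on the whole ambient space, not just on \<open>V\<close>, because multilinear forms
  are defined on all words of the ambient space.
\<close>

locale evaluations = vector_space sc for sc :: "'k::field \<Rightarrow> 'v::ab_group_add \<Rightarrow> 'v" +
  fixes V :: "'v set" and I :: "'i set" and e :: "'i \<Rightarrow> 'v \<Rightarrow> 'k"
  assumes subspace_V: "subspace V"
    and eval_add: "i \<in> I \<Longrightarrow> e i (x + y) = e i x + e i y"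
    and eval_scale: "i \<in> I \<Longrightarrow> e i (sc c x) = c * e i x"
    and eval_separates: "v \<in> V \<Longrightarrow> (\<And>i. i \<in> I \<Longrightarrow> e i v = 0) \<Longrightarrow> v = 0"
begin

lemma eval_zero: "i \<in> I \<Longrightarrow> e i 0 = 0"
  using eval_scale[of i 0 0] by simp

lemma eval_diff: "i \<in> I \<Longrightarrow> e i (x - y) = e i x - e i y"
  using eval_add[of i "x - y" y] by simp

lemma eval_sum: "i \<in> I \<Longrightarrow> e i (sum f A) = (\<Sum>a\<in>A. e i (f a))"
  by (induction A rule: infinite_finite_induct) (auto simp: eval_zero eval_add)

lemma eval_inject:
  assumes "v \<in> V" "w \<in> V" "\<And>i. i \<in> I \<Longrightarrow> e i v = e i w"
  shows "v = w"
  using eval_separates[of "v - w"] assms by (simp add: subspace_diff subspace_V eval_diff)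

lemma multilinear_eval: "set ks \<subseteq> I \<Longrightarrow> multilinear_form sc (eval_form e ks)"
  by (rule multilinear_eval_form) (auto simp: eval_add eval_scale)

text \<open>
  A vector \<open>x\<close> is added to \<open>S\<close> as in Gram-Schmidt: the defect of \<open>x\<close> under the operator that
  reproduces \<open>S\<close> is seen by some evaluation, and one more rank-one term with that evaluation
  corrects it without changing anything on \<open>S\<close>.
\<close>

lemma finite_reproducing:
  assumes "finite S" "S \<subseteq> V"
  shows "\<exists>A w. finite A \<and> A \<subseteq> I \<and> (\<forall>s\<in>S. (\<Sum>a\<in>A. sc (e a s) (w a)) = s) \<and> (\<forall>a. w a \<in> V)"
  using assms
proof (induction S)
  case empty
  show ?case by (rule exI[of _ "{}"], rule exI[of _ "\<lambda>_. 0"]) (simp add: subspace_0 subspace_V)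
next
  case (insert x S)
  then obtain A w where A: "finite A" "A \<subseteq> I" and w: "\<And>a. w a \<in> V"
    and S: "\<And>s. s \<in> S \<Longrightarrow> (\<Sum>a\<in>A. sc (e a s) (w a)) = s"
    by (metis insert_subset)
  define P where "P v = (\<Sum>a\<in>A. sc (e a v) (w a))" for v
  have PV: "P v \<in> V" for v unfolding P_def by (intro subspace_sum subspace_scale subspace_V w)
  define r where "r = x - P x"
  have rV: "r \<in> V" using insert PV by (simp add: r_def subspace_diff subspace_V)
  show ?case
  proof (cases "r = 0")
    case True
    then have "P x = x" by (simp add: r_def)
    then show ?thesis using A S w unfolding P_def by (intro exI[of _ A] exI[of _ w]) auto
  next
    case False
    then obtain b where b: "b \<in> I" "e b r \<noteq> 0" using eval_separates rV by blast
    \<comment> \<open>These vectors encode the corrected operator \<open>v \<mapsto> P v + (e b (v - P v) / e b r) r\<close>.\<close>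
    define w' where "w' a = sc (if a \<in> A then 1 else 0) (w a)
        + sc ((if a = b then 1 else 0) / e b r - (if a \<in> A then e b (w a) / e b r else 0)) r" for a
    have P': "(\<Sum>a\<in>insert b A. sc (e a v) (w' a)) = P v + sc (e b (v - P v) / e b r) r" for v
    proof -
      have "(\<Sum>a\<in>insert b A. sc (e a v) (w' a)) =
          (\<Sum>a\<in>insert b A. sc (if a \<in> A then e a v else 0) (w a))
          + sc (\<Sum>a\<in>insert b A. e a v * ((if a = b then 1 else 0) / e b r - (if a \<in> A then e b (w a) / e b r else 0))) r"
        unfolding scale_sum_left sum.distrib[symmetric] w'_def
        by (intro sum.cong) (auto simp: scale_right_distrib)
      also have "(\<Sum>a\<in>insert b A. sc (if a \<in> A then e a v else 0) (w a)) = P v"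
        unfolding P_def using A by (intro sum.mono_neutral_cong_right) auto
      also have "(\<Sum>a\<in>insert b A. e a v * ((if a = b then 1 else 0) / e b r - (if a \<in> A then e b (w a) / e b r else 0)))
        = (\<Sum>a\<in>insert b A. if a = b then e a v / e b r else 0)
          - (\<Sum>a\<in>insert b A. if a \<in> A then e a v * e b (w a) / e b r else 0)"
        unfolding sum_subtractf[symmetric] by (intro sum.cong) (auto simp: algebra_simps)
      also have "(\<Sum>a\<in>insert b A. if a = b then e a v / e b r else 0) = e b v / e b r"
        using A by simp
      also have "(\<Sum>a\<in>insert b A. if a \<in> A then e a v * e b (w a) / e b r else 0) =
          (\<Sum>a\<in>A. e a v * e b (w a) / e b r)"
        using A by (intro sum.mono_neutral_cong_right) auto
      also have "\<dots> = e b (P v) / e b r"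
        unfolding P_def using b by (simp add: eval_sum eval_scale sum_divide_distrib)
      finally show ?thesis using b by (simp add: eval_diff diff_divide_distrib)
    qed
    have "(\<Sum>a\<in>insert b A. sc (e a s) (w' a)) = s" if "s \<in> insert x S" for s
    proof (cases "s = x")
      case True
      show ?thesis unfolding P' True r_def[symmetric] using b by (simp add: r_def)
    next
      case False
      then have "P s = s" using that S[of s] by (simp add: P_def)
      then show ?thesis unfolding P' using b by (simp add: eval_zero)
    qed
    moreover have "w' a \<in> V" for a
      unfolding w'_def by (intro subspace_add subspace_scale subspace_V w rV)
    ultimately show ?thesis using A b by (intro exI[of _ "insert b A"] exI[of _ w']) auto
  qed
qed

lemma form_expansion:
  assumes A: "finite A" "A \<subseteq> I" and S: "\<And>s. s \<in> S \<Longrightarrow> (\<Sum>a\<in>A. sc (e a s) (w a)) = s"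
    and "multilinear_form sc \<beta>" "set ws \<subseteq> S"
  shows "\<beta> ws = (\<Sum>ks | set ks \<subseteq> A \<and> length ks = length ws. \<beta> (map w ks) * eval_form e ks ws)"
  using assms(4,5)
proof (induction ws arbitrary: \<beta>)
  case Nil
  have "{ks. set ks \<subseteq> A \<and> length ks = length ([] :: 'v list)} = {[]}" by auto
  then show ?case by simp
next
  case (Cons x ws)
  have zero: "\<beta> (0 # ws) = 0" using multilinear_form_scale[OF Cons.prems(1), of "[]" 0 0 ws] by simp
  have "\<beta> ((\<Sum>a\<in>B. sc (e a x) (w a)) # ws) = (\<Sum>a\<in>B. e a x * \<beta> (w a # ws))" if "finite B" for B
    using that
  proof (induction B)
    case (insert b B)
    then show ?case
      using multilinear_form_add[OF Cons.prems(1), of "[]" _ _ ws]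
        multilinear_form_scale[OF Cons.prems(1), of "[]" _ _ ws] by simp
  qed (simp add: zero)
  from this[OF A(1)] have "\<beta> (x # ws) = (\<Sum>a\<in>A. e a x * \<beta> (w a # ws))"
    unfolding S[of x, OF subsetD[OF Cons.prems(2) list.set_intros(1)]] .
  also have "\<dots> = (\<Sum>a\<in>A. e a x * (\<Sum>ks | set ks \<subseteq> A \<and> length ks = length ws. \<beta> (w a # map w ks) * eval_form e ks ws))"
  proof -
    have "multilinear_form sc (\<lambda>ys. \<beta> (w a # ys))" for a
      using multilinear_form_context[OF Cons.prems(1), of "[w a]" "[]"] by simp
    then show ?thesis using Cons.IH Cons.prems(2) by (intro sum.cong) auto
  qed
  also have "\<dots> = (\<Sum>(a, ks)\<in>A \<times> {ks. set ks \<subseteq> A \<and> length ks = length ws}.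
      \<beta> (map w (a # ks)) * eval_form e (a # ks) (x # ws))"
    by (simp add: sum_distrib_left sum.cartesian_product algebra_simps)
  also have "\<dots> = (\<Sum>ks | set ks \<subseteq> A \<and> length ks = length (x # ws). \<beta> (map w ks) * eval_form e ks (x # ws))"
    by (rule sum.reindex_bij_witness[of _ "\<lambda>ks. (hd ks, tl ks)" "\<lambda>(a, ks). a # ks"])
       (auto simp: length_Suc_conv)
  finally show ?case .
qed

text \<open>
  A tensor involves only finitely many vectors. On words in these, a reproducing operator expands
  every multilinear form into products of evaluations.
\<close>

theorem eval_separates_tensors:
  assumes t: "t \<in> tensor_space sc Vs" and Vs: "set Vs \<subseteq> {V}"
    and zero: "\<And>ks. length ks = length Vs \<Longrightarrow> set ks \<subseteq> I \<Longrightarrow> t (eval_form e ks) = 0"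
  shows "t = 0"
proof -
  \<comment> \<open>This holds if \<open>S\<close> contains the vectors of some representation of \<open>u\<close> as a sum of words, and it
    is a property of \<open>u\<close> itself, so that induction over sums applies.\<close>
  define expands where "expands S u \<longleftrightarrow> (\<forall>K g \<beta>. finite K \<and> (\<forall>ks\<in>K. set ks \<subseteq> I) \<and> multilinear_form sc \<beta> \<and>
      (\<forall>ws. set ws \<subseteq> S \<and> length ws = length Vs \<longrightarrow> \<beta> ws = (\<Sum>ks\<in>K. g ks * eval_form e ks ws)) \<longrightarrow>
      u \<beta> = (\<Sum>ks\<in>K. g ks * u (eval_form e ks)))" for S and u :: "('v, 'k) tensor"
  have expandsD: "u \<beta> = (\<Sum>ks\<in>K. g ks * u (eval_form e ks))"
    if "expands S u" "finite K" "\<forall>ks\<in>K. set ks \<subseteq> I" "multilinear_form sc \<beta>"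
      "\<forall>ws. set ws \<subseteq> S \<and> length ws = length Vs \<longrightarrow> \<beta> ws = (\<Sum>ks\<in>K. g ks * eval_form e ks ws)"
    for S u K g \<beta>
    by (rule mp[OF spec[OF spec[OF spec[OF that(1)[unfolded expands_def], of K], of g], of \<beta>]])
       (intro conjI that)
  have "\<exists>S. finite S \<and> S \<subseteq> V \<and> expands S t"
    using t
  proof (induction rule: tensor_space_induct)
    case zero
    have "expands {} 0" unfolding expands_def by (simp add: pointwise)
    then show ?case by (intro exI[of _ "{}"]) simp
  next
    case (step c ws t)
    then obtain S where S: "finite S" "S \<subseteq> V" "expands S t" by blast
    have ws: "set ws \<subseteq> V" "length ws = length Vs"
    proof -
      have "ws ! i \<in> V" if "i < length Vs" for i
        using listset_split(1)[OF step(1) that] nth_mem[OF that] Vs by auto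
      then show "set ws \<subseteq> V" "length ws = length Vs"
        using step(1) by (auto simp: listset_iff in_set_conv_nth)
    qed
    have "expands (S \<union> set ws) (fscale c (pure_tensor sc ws) + t)"
      unfolding expands_def
    proof (intro allI impI, elim conjE)
      fix K g \<beta>
      assume K: "finite K" "\<forall>ks\<in>K. set ks \<subseteq> I" and \<beta>: "multilinear_form sc \<beta>"
        and eq: "\<forall>ws'. set ws' \<subseteq> S \<union> set ws \<and> length ws' = length Vs \<longrightarrow> \<beta> ws' = (\<Sum>ks\<in>K. g ks * eval_form e ks ws')"
      have "t \<beta> = (\<Sum>ks\<in>K. g ks * t (eval_form e ks))"
        by (rule expandsD[OF S(3) K \<beta>]) (use eq in \<open>simp add: le_supI1\<close>)
      moreover have "\<beta> ws = (\<Sum>ks\<in>K. g ks * eval_form e ks ws)" using eq ws by simp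
      moreover have "pure_tensor sc ws (eval_form e ks) = eval_form e ks ws" if "ks \<in> K" for ks
        using K(2) that by (simp add: pure_tensor_def multilinear_eval)
      ultimately show "(fscale c (pure_tensor sc ws) + t) \<beta> =
          (\<Sum>ks\<in>K. g ks * (fscale c (pure_tensor sc ws) + t) (eval_form e ks))"
        using \<beta> by (simp add: pointwise distrib_left sum.distrib sum_distrib_left mult.left_commute)
          (simp add: pure_tensor_def sum_distrib_left)
    qed
    then show ?case using S ws by (intro exI[of _ "S \<union> set ws"]) auto
  qed
  then obtain S where S: "finite S" "S \<subseteq> V" "expands S t" by blast
  obtain A w where A: "finite A" "A \<subseteq> I" and w: "\<And>s. s \<in> S \<Longrightarrow> (\<Sum>a\<in>A. sc (e a s) (w a)) = s"
    using finite_reproducing[OF S(1,2)] by blast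
  have "t \<beta> = 0" for \<beta>
  proof (cases "multilinear_form sc \<beta>")
    case True
    let ?K = "{ks. set ks \<subseteq> A \<and> length ks = length Vs}"
    have "t \<beta> = (\<Sum>ks\<in>?K. \<beta> (map w ks) * t (eval_form e ks))"
    proof (rule expandsD[OF S(3) _ _ True])
      show "\<forall>ws. set ws \<subseteq> S \<and> length ws = length Vs \<longrightarrow>
          \<beta> ws = (\<Sum>ks\<in>?K. \<beta> (map w ks) * eval_form e ks ws)"
        using form_expansion[OF A w True] by simp
    qed (use A in \<open>auto simp: finite_lists_length_eq\<close>)
    moreover have "t (eval_form e ks) = 0" if "ks \<in> ?K" for ks
      using that zero A(2) by auto
    ultimately show ?thesis by simp
  next
    case False
    show ?thesis using t
      by (induction rule: tensor_space_induct) (simp_all add: pointwise pure_tensor_def False)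
  qed
  then show ?thesis by (simp add: fun_eq_iff pointwise)
qed

lemma tensor_eqI:
  assumes "t \<in> tensor_space sc Vs" "u \<in> tensor_space sc Vs" "set Vs \<subseteq> {V}"
    and "\<And>ks. length ks = length Vs \<Longrightarrow> set ks \<subseteq> I \<Longrightarrow> t (eval_form e ks) = u (eval_form e ks)"
  shows "t = u"
proof -
  have "t - u = 0"
    using assms by (intro eval_separates_tensors[of _ Vs] fs.subspace_diff subspace_tensor_space) auto
  then show ?thesis by simp
qed

text \<open>
  Applying \<open>\<rho>\<close> to one factor and then evaluating is evaluating at a shorter word, provided that
  the evaluation of \<open>\<rho> x\<close> at \<open>js\<close> is a single evaluation of \<open>x\<close>.
\<close>

lemma apply_at_eval:
  assumes t: "t \<in> tensor_space sc Vs" and Vs: "set Vs \<subseteq> {V}" and i: "length ks < length Vs"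
    and \<rho>: "linear_on sc fscale V \<rho>" "\<And>x. x \<in> V \<Longrightarrow> \<rho> x \<in> tensor_space sc Us"
    and len: "length js = length Us" "length ls = length Vs - Suc (length ks)"
    and I: "set (ks @ m # js @ ls) \<subseteq> I"
    and m: "\<And>x. x \<in> V \<Longrightarrow> \<rho> x (eval_form e js) = e m x"
  shows "apply_at sc Vs (length ks) \<rho> t (eval_form e (ks @ js @ ls)) = t (eval_form e (ks @ m # ls))"
proof -
  have Vi: "Vs ! length ks = V" using Vs i by (auto dest: nth_mem)
  have sub: "\<forall>V\<in>set Vs. subspace V" using Vs subspace_V by auto
  show ?thesis
  proof (rule apply_at_form[OF vector_space_axioms sub i])
    fix ws assume ws: "ws \<in> listset Vs"
    let ?us = "take (length ks) ws" and ?vs = "drop (Suc (length ks)) ws"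
    have x: "ws ! length ks \<in> V" using listset_split(1)[OF ws i] Vi by simp
    have lws: "length ws = length Vs" using ws by (simp add: listset_iff)
    have split: "ws = ?us @ ws ! length ks # ?vs" using i lws by (simp add: id_take_nth_drop)
    have js: "multilinear_form sc (eval_form e js)" using I by (intro multilinear_eval) auto
    have "\<rho> (ws ! length ks) (\<lambda>ys. eval_form e (ks @ js @ ls) (?us @ ys @ ?vs)) =
        \<rho> (ws ! length ks) (\<lambda>ys. (eval_form e ks ?us * eval_form e ls ?vs) * eval_form e js ys)"
    proof (rule tensor_form_cong[OF \<rho>(2)[OF x]])
      show "multilinear_form sc (\<lambda>ys. eval_form e (ks @ js @ ls) (?us @ ys @ ?vs))"
        using I by (intro multilinear_form_context multilinear_eval) auto
      show "multilinear_form sc (\<lambda>ys. (eval_form e ks ?us * eval_form e ls ?vs) * eval_form e js ys)"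
        by (intro multilinear_form_times js)
      fix ys assume "ys \<in> listset Us"
      then have "length ys = length js" using len by (simp add: listset_iff)
      then show "eval_form e (ks @ js @ ls) (?us @ ys @ ?vs) = (eval_form e ks ?us * eval_form e ls ?vs) * eval_form e js ys"
        using i lws by (simp add: eval_form_append)
    qed
    also have "\<dots> = eval_form e ks ?us * eval_form e ls ?vs * e m (ws ! length ks)"
      by (simp add: tensor_form_times[OF \<rho>(2)[OF x] js] m x)
    also have "\<dots> = eval_form e (ks @ m # ls) (?us @ ws ! length ks # ?vs)"
      using i lws by (simp add: eval_form_append)
    finally show "eval_form e (ks @ m # ls) ws =
        \<rho> (ws ! length ks) (\<lambda>ys. eval_form e (ks @ js @ ls) (?us @ ys @ ?vs))"
      using split by simp
  qed (use I Vi \<rho> t in \<open>auto intro!: multilinear_eval\<close>)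
qed

end

section \<open>Coalgebras represented by a monoid of evaluations\<close>

text \<open>
  A coalgebra of representative functions on a monoid: its elements are told apart by their values
  at the elements of the monoid, and the comultiplication is \<open>c \<mapsto> ((m, n) \<mapsto> c (m n))\<close>.
\<close>

locale represented_coalgebra =
  evaluations "scal C" "carr C" "UNIV :: 'm set" e + monoid mul one
  for C :: "('k::field, 'v::ab_group_add) coalg" and e :: "'m \<Rightarrow> 'v \<Rightarrow> 'k"
    and mul :: "'m \<Rightarrow> 'm \<Rightarrow> 'm" and one :: 'm +
  assumes comult_in: "c \<in> carr C \<Longrightarrow> comult C c \<in> tensor_space (scal C) [carr C, carr C]"
    and comult_eval: "c \<in> carr C \<Longrightarrow> comult C c (eval_form e [m, n]) = e (mul m n) c"
    and counit_eval: "c \<in> carr C \<Longrightarrow> counit C c = e one c"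
begin

lemma comult_linear: "linear_on (scal C) fscale (carr C) (comult C)"
  unfolding linear_on_def
proof (intro conjI ballI allI)
  fix x y c
  assume x: "x \<in> carr C"
  have ml: "multilinear_form (scal C) (eval_form e ks)" for ks by (rule multilinear_eval) simp
  have two: "\<exists>m n. ks = [m, n]" if "length ks = length [carr C, carr C]" for ks :: "'m list"
    using that by (auto simp: length_Suc_conv)
  show "comult C (scal C c x) = fscale c (comult C x)"
  proof (rule tensor_eqI[where Vs = "[carr C, carr C]"])
    show "fscale c (comult C x) \<in> tensor_space (scal C) [carr C, carr C]"
      by (intro fs.subspace_scale subspace_tensor_space comult_in x)
    fix ks :: "'m list"
    assume "length ks = length [carr C, carr C]"
    then show "comult C (scal C c x) (eval_form e ks) = fscale c (comult C x) (eval_form e ks)"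
      using two[of ks] x by (auto simp: comult_eval subspace_scale subspace_V eval_scale pointwise simp del: eval_form.simps)
  qed (auto intro: comult_in subspace_scale subspace_V x)
  assume y: "y \<in> carr C"
  show "comult C (x + y) = comult C x + comult C y"
  proof (rule tensor_eqI[where Vs = "[carr C, carr C]"])
    show "comult C x + comult C y \<in> tensor_space (scal C) [carr C, carr C]"
      by (intro fs.subspace_add subspace_tensor_space comult_in x y)
    fix ks :: "'m list"
    assume "length ks = length [carr C, carr C]"
    then show "comult C (x + y) (eval_form e ks) = (comult C x + comult C y) (eval_form e ks)"
      using two[of ks] x y by (auto simp: comult_eval subspace_add subspace_V eval_add pointwise simp del: eval_form.simps)
  qed (auto intro: comult_in subspace_add subspace_V x y)
qed

text \<open>
  Coassociativity and the counit laws say that two tensors agree; evaluated at words in the monoid,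
  they become associativity and the unit laws of the monoid.
\<close>

theorem represented_is_coalgebra: "coalgebra C"
proof -
  let ?V = "carr C" and ?s = "scal C"
  have counit_linear: "linear_on ?s (*) ?V (counit C)"
    using subspace_add[OF subspace_V] subspace_scale[OF subspace_V]
    by (auto simp: linear_on_def counit_eval eval_add eval_scale)
  have sub: "\<forall>V\<in>set [?V, ?V]. subspace V" using subspace_V by simp
  \<comment> \<open>Both sides are evaluated at \<open>[l, m, n]\<close>, giving \<open>(l m) n\<close> and \<open>l (m n)\<close>.\<close>
  have coassoc: "apply_at ?s [?V, ?V] 0 (comult C) (comult C c) =
      apply_at ?s [?V, ?V] 1 (comult C) (comult C c)" if c: "c \<in> ?V" for c
  proof (rule tensor_eqI[where Vs = "[?V, ?V, ?V]"])
    show "apply_at ?s [?V, ?V] 0 (comult C) (comult C c) \<in> tensor_space ?s [?V, ?V, ?V]"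
      using apply_at_in[OF vector_space_axioms sub, of 0 "comult C" "[?V, ?V]", OF _ _ _ comult_in[OF c]]
        comult_linear comult_in by simp
    show "apply_at ?s [?V, ?V] 1 (comult C) (comult C c) \<in> tensor_space ?s [?V, ?V, ?V]"
      using apply_at_in[OF vector_space_axioms sub, of 1 "comult C" "[?V, ?V]", OF _ _ _ comult_in[OF c]]
        comult_linear comult_in by simp
    fix ks :: "'m list" assume "length ks = length [?V, ?V, ?V]"
    then obtain l m n where ks: "ks = [l, m, n]" by (auto simp: length_Suc_conv)
    have "apply_at ?s [?V, ?V] 0 (comult C) (comult C c) (eval_form e ks) = e (mul (mul l m) n) c"
      using apply_at_eval[OF comult_in[OF c], where ks = "[]" and js = "[l, m]" and ls = "[n]"
          and m = "mul l m" and \<rho> = "comult C" and Us = "[?V, ?V]"] comult_linear comult_in comult_eval c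
      by (simp add: ks del: eval_form.simps)
    moreover have "apply_at ?s [?V, ?V] 1 (comult C) (comult C c) (eval_form e ks) = e (mul l (mul m n)) c"
      using apply_at_eval[OF comult_in[OF c], where ks = "[l]" and js = "[m, n]" and ls = "[]"
          and m = "mul m n" and \<rho> = "comult C" and Us = "[?V, ?V]"] comult_linear comult_in comult_eval c
      by (simp add: ks del: eval_form.simps)
    ultimately show "apply_at ?s [?V, ?V] 0 (comult C) (comult C c) (eval_form e ks) =
        apply_at ?s [?V, ?V] 1 (comult C) (comult C c) (eval_form e ks)"
      by (simp add: assoc)
  qed simp
  have counit_law: "apply_at ?s [?V, ?V] i (\<lambda>v. fscale (counit C v) (pure_tensor ?s [])) (comult C c) =
      pure_tensor ?s [c]" if c: "c \<in> ?V" and i: "i \<in> {0, 1}" for c i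
  proof -
    let ?\<rho> = "\<lambda>v. fscale (counit C v) (pure_tensor ?s [])"
    have \<rho>: "linear_on ?s fscale ?V ?\<rho>"
      using counit_linear by (auto simp: linear_on_def fun_eq_iff pointwise algebra_simps)
    have \<rho>_in: "?\<rho> x \<in> tensor_space ?s []" for x
      by (intro fs.subspace_scale subspace_tensor_space pure_in_tensor_space) simp
    have \<rho>_eval: "?\<rho> x (eval_form e []) = e one x" if "x \<in> ?V" for x
      using that by (simp add: pointwise pure_tensor_def multilinear_eval counit_eval)
    have pure: "pure_tensor ?s [c] (eval_form e [m]) = e m c" for m
      by (simp add: pure_tensor_def multilinear_eval)
    show ?thesis
    proof (rule tensor_eqI[where Vs = "[?V]"])
      have "i < 2" "[?V, ?V] ! i = ?V" "take i [?V, ?V] @ [] @ drop (Suc i) [?V, ?V] = [?V]"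
        using i by auto
      then show "apply_at ?s [?V, ?V] i ?\<rho> (comult C c) \<in> tensor_space ?s [?V]"
        using apply_at_in[OF vector_space_axioms sub, of i ?\<rho> "[]", OF _ _ _ comult_in[OF c]] \<rho> \<rho>_in
        by (simp del: append.simps)
      show "pure_tensor ?s [c] \<in> tensor_space ?s [?V]"
        using c by (intro pure_in_tensor_space) (simp add: listset_iff)
      fix ks :: "'m list" assume "length ks = length [?V]"
      then obtain m where ks: "ks = [m]" by (auto simp: length_Suc_conv)
      have "apply_at ?s [?V, ?V] 0 ?\<rho> (comult C c) (eval_form e [m]) = e (mul one m) c"
        using apply_at_eval[OF comult_in[OF c], where ks = "[]" and js = "[]" and ls = "[m]"
            and m = one and \<rho> = ?\<rho> and Us = "[]"] \<rho> \<rho>_in \<rho>_eval comult_eval c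
        by (simp del: eval_form.simps)
      moreover have "apply_at ?s [?V, ?V] 1 ?\<rho> (comult C c) (eval_form e [m]) = e (mul m one) c"
        using apply_at_eval[OF comult_in[OF c], where ks = "[m]" and js = "[]" and ls = "[]"
            and m = one and \<rho> = ?\<rho> and Us = "[]"] \<rho> \<rho>_in \<rho>_eval comult_eval c
        by (simp del: eval_form.simps)
      ultimately show "apply_at ?s [?V, ?V] i ?\<rho> (comult C c) (eval_form e ks) = pure_tensor ?s [c] (eval_form e ks)"
        using i by (auto simp: ks pure simp del: eval_form.simps)
    qed simp
  qed
  show ?thesis
    unfolding coalgebra_def
    using vector_space_axioms subspace_V comult_in comult_linear counit_linear coassoc counit_law
    by blast
qed

end

lemma linear_on_if_eval_preserving:
  assumes ev: "evaluations sc V I e" and ev': "evaluations sc' V' I e'"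
    and h: "h ` V \<subseteq> V'" and eh: "\<And>i v. i \<in> I \<Longrightarrow> v \<in> V \<Longrightarrow> e' i (h v) = e i v"
  shows "linear_on sc sc' V h"
  unfolding linear_on_def
proof (intro conjI ballI allI)
  interpret ev: evaluations sc V I e by fact
  interpret ev': evaluations sc' V' I e' by fact
  have hV: "h v \<in> V'" if "v \<in> V" for v using h that by blast
  fix x y c assume x: "x \<in> V"
  then have cx: "sc c x \<in> V" by (intro ev.subspace_scale ev.subspace_V)
  show "h (sc c x) = sc' c (h x)"
    by (rule ev'.eval_inject)
       (auto simp: hV x cx eh ev.eval_scale ev'.eval_scale ev'.subspace_V ev'.subspace_scale)
  assume y: "y \<in> V"
  then have xy: "x + y \<in> V" by (intro ev.subspace_add ev.subspace_V x)
  show "h (x + y) = h x + h y"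
    by (rule ev'.eval_inject)
       (auto simp: hV x y xy eh ev.eval_add ev'.eval_add ev'.subspace_V ev'.subspace_add)
qed

text \<open>
  The transport of a tensor along \<open>h\<close>, in the form in which it enters the definition of a coalgebra
  morphism.
\<close>

lemma tensor_map_eval:
  assumes ev: "evaluations sc V I e" and ev': "evaluations sc' V' I e'"
    and h: "h ` V \<subseteq> V'"
    and eh: "\<And>i v. i \<in> I \<Longrightarrow> v \<in> V \<Longrightarrow> e' i (h v) = e i v"
    and t: "t \<in> tensor_space sc [V, V]"
  shows "tensor_lift sc [V, V] (\<lambda>ws. pure_tensor sc' (map h ws)) t \<in> tensor_space sc' [V', V']"
    and "i \<in> I \<Longrightarrow> j \<in> I \<Longrightarrow>
      tensor_lift sc [V, V] (\<lambda>ws. pure_tensor sc' (map h ws)) t (eval_form e' [i, j]) = t (eval_form e [i, j])"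
proof -
  interpret ev: evaluations sc V I e by fact
  interpret ev': evaluations sc' V' I e' by fact
  have lin: "linear_on sc sc' V h" by (rule linear_on_if_eval_preserving[OF ev ev' h eh])
  have sub: "\<forall>V\<in>set [V, V]. ev.subspace V" using ev.subspace_V by simp
  have ml: "multilinear_on sc [V, V] (\<lambda>ws. pure_tensor sc' (map h ws))"
  proof (rule multilinear_onI)
    fix us x ws
    assume x: "us @ x # ws \<in> listset [V, V]"
    have xV: "z \<in> V" if "us @ z # ws \<in> listset [V, V]" for z
      using that by (auto simp: append_eq_Cons_conv Cons_eq_append_conv set_Cons_def)
    {
      fix y assume y: "us @ y # ws \<in> listset [V, V]"
      have "h (x + y) = h x + h y" using lin xV x y by (auto simp: linear_on_def)
      then show "pure_tensor sc' (map h (us @ (x + y) # ws)) =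
          pure_tensor sc' (map h (us @ x # ws)) + pure_tensor sc' (map h (us @ y # ws))"
        by (simp add: pure_tensor_add)
    }
    fix c
    have "h (sc c x) = sc' c (h x)" using lin xV x by (auto simp: linear_on_def)
    then show "pure_tensor sc' (map h (us @ sc c x # ws)) = fscale c (pure_tensor sc' (map h (us @ x # ws)))"
      by (simp add: pure_tensor_times)
  qed
  show "tensor_lift sc [V, V] (\<lambda>ws. pure_tensor sc' (map h ws)) t \<in> tensor_space sc' [V', V']"
    using h unfolding image_subset_iff by (intro tensor_lift_in_subspace[OF ev.vector_space_axioms sub ml subspace_tensor_space _ t]
        pure_in_tensor_space) (auto simp: set_Cons_def)
  assume ij: "i \<in> I" "j \<in> I"
  show "tensor_lift sc [V, V] (\<lambda>ws. pure_tensor sc' (map h ws)) t (eval_form e' [i, j]) = t (eval_form e [i, j])"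
  proof (rule tensor_lift_eval[OF ev.vector_space_axioms sub ml _ _ t])
    show "multilinear_form sc (eval_form e [i, j])" using ij by (intro ev.multilinear_eval) simp
    have "multilinear_form sc' (eval_form e' [i, j])" using ij by (intro ev'.multilinear_eval) simp
    then show "pure_tensor sc' (map h ws) (eval_form e' [i, j]) = eval_form e [i, j] ws"
      if "ws \<in> listset [V, V]" for ws
      using that ij by (auto simp: set_Cons_def pure_tensor_def eh)
  qed
qed

text \<open>
  The monoid determines the structure, so a bijection that preserves values is an isomorphism.
\<close>

theorem represented_coalgebra_iso:
  assumes C: "represented_coalgebra C e mul one" and E: "represented_coalgebra E e' mul one"
    and h: "bij_betw h (carr C) (carr E)" and eh: "\<And>m c. c \<in> carr C \<Longrightarrow> e' m (h c) = e m c"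
  shows "coalgebra_iso C E h"
proof -
  interpret C: represented_coalgebra C e mul one by fact
  interpret E: represented_coalgebra E e' mul one by fact
  have hE: "h c \<in> carr E" if "c \<in> carr C" for c using h that by (auto simp: bij_betw_def)
  have lin: "linear_on (scal C) (scal E) (carr C) h"
    using hE eh
    by (intro linear_on_if_eval_preserving[OF C.evaluations_axioms E.evaluations_axioms]) auto
  have "comult E (h c) = tensor_lift (scal C) [carr C, carr C] (\<lambda>ws. pure_tensor (scal E) (map h ws)) (comult C c)"
    if c: "c \<in> carr C" for c
  proof (rule E.tensor_eqI[where Vs = "[carr E, carr E]"])
    note map = tensor_map_eval[OF C.evaluations_axioms E.evaluations_axioms _ _ C.comult_in[OF c]]
    show "comult E (h c) \<in> tensor_space (scal E) [carr E, carr E]" by (intro E.comult_in hE c)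
    show "tensor_lift (scal C) [carr C, carr C] (\<lambda>ws. pure_tensor (scal E) (map h ws)) (comult C c)
        \<in> tensor_space (scal E) [carr E, carr E]"
      using hE eh by (intro map(1)) auto
    fix ks :: "'c list" assume "length ks = length [carr E, carr E]"
    then obtain m n where ks: "ks = [m, n]" by (auto simp: length_Suc_conv)
    have "tensor_lift (scal C) [carr C, carr C] (\<lambda>ws. pure_tensor (scal E) (map h ws)) (comult C c) (eval_form e' [m, n])
        = comult C c (eval_form e [m, n])"
      using hE eh by (intro map(2)) auto
    then show "comult E (h c) (eval_form e' ks) = tensor_lift (scal C) [carr C, carr C]
        (\<lambda>ws. pure_tensor (scal E) (map h ws)) (comult C c) (eval_form e' ks)"
      by (simp add: ks E.comult_eval C.comult_eval hE c eh del: eval_form.simps)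
  qed simp
  then show ?thesis
    unfolding coalgebra_iso_def
    using C.represented_is_coalgebra E.represented_is_coalgebra h lin hE eh
    by (simp add: C.counit_eval E.counit_eval)
qed

section \<open>Dual coalgebras\<close>

lemma evaluations_at_points:
  "fs.subspace V \<Longrightarrow> evaluations fscale V UNIV (\<lambda>a f. f a)"
  by unfold_locales (auto simp: pointwise fun_eq_iff)

lemma pair_form_eq:
  "(\<lambda>ws. case ws of [g, h] \<Rightarrow> g a * h b | _ \<Rightarrow> 0) = eval_form (\<lambda>a f. f a) [a, b]"
  (is "?f = ?g")
proof
  fix ws
  show "?f ws = ?g ws"
    by (auto split: list.splits simp: neq_Nil_conv eval_form_length)
qed

text \<open>
  Evaluations at points separate tensors of functions, so the description defining the
  comultiplication has at most one solution.
\<close>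

lemma dual_comult_eq:
  assumes "fs.subspace V" "t \<in> tensor_space fscale [V, V]"
    and "\<And>a b. t (eval_form (\<lambda>a f. f a) [a, b]) = f (a * b)"
  shows "comult (dual_coalg_on V) f = t"
proof -
  interpret evaluations fscale V UNIV "\<lambda>a f. f a" by (rule evaluations_at_points) fact
  show ?thesis
    unfolding dual_coalg_on_def coalg.simps pair_form_eq
  proof (rule the_equality)
    fix u assume u: "u \<in> tensor_space fscale [V, V] \<and> (\<forall>a b. u (eval_form (\<lambda>a f. f a) [a, b]) = f (a * b))"
    show "u = t"
    proof (rule tensor_eqI[where Vs = "[V, V]"])
      fix ks :: "'b list" assume "length ks = length [V, V]"
      then obtain a b where "ks = [a, b]" by (auto simp: length_Suc_conv)
      then show "u (eval_form (\<lambda>a f. f a) ks) = t (eval_form (\<lambda>a f. f a) ks)"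
        using u assms(3) by simp
    qed (use u assms in auto)
  qed (use assms in auto)
qed

definition annihilator :: "('k::field \<Rightarrow> 'a::ring_1 \<Rightarrow> 'a) \<Rightarrow> 'a set \<Rightarrow> ('a \<Rightarrow> 'k) set" where
  "annihilator sA I = {f \<in> linear_dual sA. \<forall>x\<in>I. f x = 0}"

lemma linear_dual_iff:
  fixes sA :: "'k::field \<Rightarrow> 'a::ring_1 \<Rightarrow> 'a"
  assumes "vector_space sA"
  shows "f \<in> linear_dual sA \<longleftrightarrow> (\<forall>x y. f (x + y) = f x + f y) \<and> (\<forall>c x. f (sA c x) = c * f x)"
proof -
  have "vector_space ((*) :: 'k \<Rightarrow> 'k \<Rightarrow> 'k)" by unfold_locales (auto simp: algebra_simps)
  with assms show ?thesis
    by (auto simp: linear_dual_def Vector_Spaces.linear_iff)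
qed

lemma subspace_annihilator:
  assumes "vector_space sA"
  shows "fs.subspace (annihilator sA I)"
  by (rule fs.subspaceI)
     (auto simp: annihilator_def linear_dual_iff[OF assms] pointwise algebra_simps)

text \<open>
  Forms annihilating \<open>I\<close> are determined by their values on a finite set \<open>S\<close> spanning modulo \<open>I\<close>,
  so \<open>g = \<Sum> g s * w s\<close> for suitable \<open>w s\<close> annihilating \<open>I\<close>. Applied to \<open>g x = f (x * b)\<close>, this
  separates the two factors in \<open>f (a * b)\<close>.
\<close>

lemma annihilator_comult_exists:
  assumes A: "algebra_scale sA" and I: "two_sided_ideal I" "finite_codim sA I"
    and f: "f \<in> annihilator sA I"
  shows "\<exists>t \<in> tensor_space fscale [annihilator sA I, annihilator sA I].
    \<forall>a b. t (eval_form (\<lambda>a f. f a) [a, b]) = f (a * b)"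
proof -
  let ?W = "annihilator sA I"
  have vs: "vector_space sA" and sA: "\<And>c x y. sA c (x * y) = sA c x * y" "\<And>c x y. sA c (x * y) = x * sA c y"
    using A unfolding algebra_scale_def by blast+
  interpret A: vector_space sA by (rule vs)
  note lin = linear_dual_iff[OF vs]
  obtain S where S: "finite S" "A.span (S \<union> I) = UNIV" using I(2) by (auto simp: finite_codim_def)
  define L :: "('b \<Rightarrow> 'a) \<Rightarrow> 'b \<Rightarrow> 'a" where "L g = (\<lambda>s. if s \<in> S then g s else 0)" for g
  interpret P: vector_space_pair "fscale :: 'a \<Rightarrow> ('b \<Rightarrow> 'a) \<Rightarrow> _" "fscale :: 'a \<Rightarrow> ('b \<Rightarrow> 'a) \<Rightarrow> _" ..
  have linL: "Vector_Spaces.linear fscale fscale L"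
    unfolding Vector_Spaces.linear_iff by (auto simp: L_def pointwise fun_eq_iff vector_space_fscale)
  have inj: "inj_on L ?W"
  proof (rule inj_onI)
    fix g g' assume g: "g \<in> ?W" "g' \<in> ?W" and eq: "L g = L g'"
    show "g = g'"
    proof
      fix x
      have "x \<in> A.span (S \<union> I)" using S by simp
      then show "g x = g' x"
      proof (induction rule: A.span_induct_alt)
        case base
        show ?case using g I(1) by (simp add: annihilator_def two_sided_ideal_def)
      next
        case (step c x y)
        have "g x = g' x"
          using step(1) g fun_cong[OF eq, of x] by (auto simp: L_def annihilator_def)
        then show ?case using g step by (simp add: annihilator_def lin)
      qed
    qed
  qed
  obtain R where R: "range R \<subseteq> ?W" "Vector_Spaces.linear fscale fscale R" "\<And>g. g \<in> ?W \<Longrightarrow> R (L g) = g"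
    using P.linear_exists_left_inverse_on[OF linL subspace_annihilator[OF vs] inj] by auto
  define w where "w s = R (\<lambda>x. if x = s then 1 else 0)" for s
  have expand: "g x = (\<Sum>s\<in>S. g s * w s x)" if "g \<in> ?W" for g x
  proof -
    have "L g = (\<Sum>s\<in>S. fscale (g s) (\<lambda>x. if x = s then 1 else 0))"
      using S(1) by (auto simp: fun_eq_iff sum_fun_apply pointwise L_def if_distrib cong: if_cong)
    then have "g = R (\<Sum>s\<in>S. fscale (g s) (\<lambda>x. if x = s then 1 else 0))" using R(3)[OF that] by simp
    also have "\<dots> = (\<Sum>s\<in>S. fscale (g s) (w s))"
      using R(2) by (simp add: P.linear_sum P.linear_scale w_def)
    finally have "g = (\<Sum>s\<in>S. fscale (g s) (w s))" .
    from fun_cong[OF this, of x] show ?thesis unfolding sum_fun_apply fscale_apply .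
  qed
  have wW: "w s \<in> ?W" for s using R(1) by (auto simp: w_def)
  have right: "(\<lambda>x. f (x * b)) \<in> ?W" and left: "(\<lambda>x. f (b * x)) \<in> ?W" for b
    using f I(1) by (auto simp: annihilator_def lin two_sided_ideal_def algebra_simps sA(1)[symmetric] sA(2)[symmetric])
  define t where "t = (\<Sum>s\<in>S. pure_tensor fscale [w s, \<lambda>x. f (s * x)])"
  interpret W: evaluations fscale ?W UNIV "\<lambda>a f. f a"
    by (intro evaluations_at_points subspace_annihilator vs)
  have "t \<in> tensor_space fscale [?W, ?W]"
    unfolding t_def using wW left
    by (intro fs.subspace_sum subspace_tensor_space pure_in_tensor_space) (simp add: set_Cons_def)
  moreover have "t (eval_form (\<lambda>a f. f a) [a, b]) = f (a * b)" for a b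
  proof -
    have "t (eval_form (\<lambda>a f. f a) [a, b]) = (\<Sum>s\<in>S. w s a * f (s * b))"
      by (simp add: t_def sum_fun_apply pure_tensor_def W.multilinear_eval)
    also have "\<dots> = f (a * b)" using expand[OF right[of b], of a] by (simp add: mult.commute)
    finally show ?thesis .
  qed
  ultimately show ?thesis by blast
qed

section \<open>Cotensor powers of the dual of a finite-dimensional algebra\<close>

locale finite_dimensional_algebra = finite_dimensional_vector_space scale Basis
  for scale :: "'k::field \<Rightarrow> 'd::ring_1 \<Rightarrow> 'd" and Basis :: "'d set" +
  assumes algebra_scale: "algebra_scale scale"
begin

abbreviation "C \<equiv> dual_coalg scale"
abbreviation "E \<equiv> eval_form (\<lambda>a (f :: 'd \<Rightarrow> 'k). f a)"

lemma dual_carr: "carr C = annihilator scale {0}" and dual_scal: "scal C = fscale"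
proof -
  have "f 0 = 0" if "f \<in> linear_dual scale" for f
    using that linear_dual_iff[OF vector_space_axioms, of f] scale_zero_left[of 0] mult_zero_left by metis
  then show "carr C = annihilator scale {0}"
    by (auto simp: dual_coalg_def dual_coalg_on_def annihilator_def)
qed (simp add: dual_coalg_def dual_coalg_on_def)

lemma dual_represented: "represented_coalgebra C (\<lambda>a f. f a) (*) 1"
proof -
  have sub: "fs.subspace (carr C)"
    unfolding dual_carr by (rule subspace_annihilator) (rule vector_space_axioms)
  interpret ev: evaluations "scal C" "carr C" UNIV "\<lambda>a f. f a"
    unfolding dual_scal by (rule evaluations_at_points[OF sub])
  have "two_sided_ideal {0 :: 'd}" by (simp add: two_sided_ideal_def)
  moreover have "finite_codim scale {0}"
    unfolding finite_codim_def using finite_Basis span_Basis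
    by (intro exI[of _ Basis] conjI) (auto simp: span_insert_0)
  ultimately have ex: "\<exists>t \<in> tensor_space fscale [carr C, carr C]. \<forall>a b. t (E [a, b]) = f (a * b)"
    if "f \<in> carr C" for f
    using that unfolding dual_carr by (intro annihilator_comult_exists algebra_scale)
  have comult: "comult C f \<in> tensor_space fscale [carr C, carr C] \<and> comult C f (E [a, b]) = f (a * b)"
    if f: "f \<in> carr C" for f a b
  proof -
    obtain t where t: "t \<in> tensor_space fscale [carr C, carr C]" "\<And>a b. t (E [a, b]) = f (a * b)"
      using ex[OF f] by blast
    have carr: "carr C = linear_dual scale" by (simp add: dual_coalg_def dual_coalg_on_def)
    have "comult C f = t"
      unfolding dual_coalg_def using t sub unfolding carr by (intro dual_comult_eq) auto
    then show ?thesis using t by simp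
  qed
  show ?thesis
  proof unfold_locales
    show "counit C c = c 1" for c by (simp add: dual_coalg_def dual_coalg_on_def)
  qed (use comult in \<open>auto simp: dual_scal mult.assoc simp del: eval_form.simps\<close>)
qed

sublocale dual: represented_coalgebra C "\<lambda>a f. f a" "(*)" 1
  by (rule dual_represented)

abbreviation "V \<equiv> carr C"
abbreviation "Vn n \<equiv> tensor_space (scal C) (replicate n V)"

lemma E_form: "multilinear_form (scal C) (E ks)"
  by (rule dual.multilinear_eval) simp

lemma subspace_Vn: "\<forall>W\<in>set (replicate n V). dual.subspace W"
  using dual.subspace_V by auto

lemma Vn_eqI:
  assumes "t \<in> Vn n" "u \<in> Vn n" "\<And>ks. length ks = n \<Longrightarrow> t (E ks) = u (E ks)"
  shows "t = u"
  using assms by (intro dual.tensor_eqI[where Vs = "replicate n V"]) auto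

lemma apply_comult_in:
  assumes "t \<in> Vn n" "i < n"
  shows "apply_at (scal C) (replicate n V) i (comult C) t \<in> Vn (Suc n)"
proof -
  have "take i (replicate n V) @ [V, V] @ drop (Suc i) (replicate n V) = replicate (Suc n) V"
    using assms(2) by (intro replicate_eqI) auto
  then show ?thesis
    using apply_at_in[OF dual.vector_space_axioms subspace_Vn, of i n "comult C" "[V, V]", OF _ _ _ assms(1)]
      assms(2) dual.comult_linear dual.comult_in by simp
qed

lemma apply_comult_eval:
  assumes "t \<in> Vn n" "Suc (length ks + length ls) = n"
  shows "apply_at (scal C) (replicate n V) (length ks) (comult C) t (E (ks @ a # b # ls)) =
    t (E (ks @ (a * b) # ls))"
  using dual.apply_at_eval[OF assms(1), where ks = ks and js = "[a, b]" and ls = ls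
      and m = "a * b" and \<rho> = "comult C" and Us = "[V, V]"]
    assms(2) dual.comult_linear dual.comult_in dual.comult_eval by auto

text \<open>
  Evaluated at words, the cotensor condition says that \<open>t\<close> takes the same value at words which
  differ by moving a factor from a letter to its neighbour. Hence \<open>t\<close> only depends on the product of
  the letters.
\<close>

lemma cotensor_power_iff:
  "t \<in> cotensor_power C V (comult C) (comult C) n \<longleftrightarrow>
    t \<in> Vn (Suc (n - 1)) \<and>
    (\<forall>ks. length ks = Suc (n - 1) \<longrightarrow> t (E ks) = t (E (prod_list ks # replicate (n - 1) 1)))"
proof (cases n)
  case 0
  then show ?thesis by (auto simp: cotensor_power_def length_Suc_conv)
next
  case (Suc m)
  let ?ap = "apply_at (scal C) (replicate n V)"
  have Vn: "t \<in> cotensor_power C V (comult C) (comult C) n \<longleftrightarrow>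
      t \<in> Vn n \<and> (\<forall>i. Suc i < n \<longrightarrow> ?ap i (comult C) t = ?ap (Suc i) (comult C) t)"
    by (simp add: cotensor_power_def Suc)
  show ?thesis
  proof
    assume "t \<in> cotensor_power C V (comult C) (comult C) n"
    then have t: "t \<in> Vn n" and eq: "\<And>i. Suc i < n \<Longrightarrow> ?ap i (comult C) t = ?ap (Suc i) (comult C) t"
      using Vn by auto
    \<comment> \<open>The cotensor condition at the letters \<open>a, b, 1\<close>.\<close>
    have move: "t (E (ks @ (a * b) # 1 # ls)) = t (E (ks @ a # b # ls))"
      if "Suc (Suc (length ks + length ls)) = n" for ks ls a b
    proof -
      have "?ap (length ks) (comult C) t (E (ks @ a # b # 1 # ls)) = t (E (ks @ (a * b) # 1 # ls))"
        using that by (intro apply_comult_eval[OF t]) simp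
      moreover have "?ap (length (ks @ [a])) (comult C) t (E ((ks @ [a]) @ b # 1 # ls)) =
          t (E ((ks @ [a]) @ (b * 1) # ls))"
        using that by (intro apply_comult_eval[OF t]) simp
      moreover have "?ap (length ks) (comult C) t = ?ap (length (ks @ [a])) (comult C) t"
        using eq[of "length ks"] that by simp
      ultimately show ?thesis by simp
    qed
    have collect: "t (E (ks @ a # ls)) = t (E (ks @ (a * prod_list ls) # replicate (length ls) 1))"
      if "Suc (length ks + length ls) = n" for ks a ls
      using that
    proof (induction ls arbitrary: ks a)
      case (Cons b ls)
      have "t (E (ks @ a # b # ls)) = t (E ((ks @ [a]) @ (b * prod_list ls) # replicate (length ls) 1))"
        using Cons.IH[of "ks @ [a]" b] Cons.prems by simp
      also have "\<dots> = t (E (ks @ (a * (b * prod_list ls)) # 1 # replicate (length ls) 1))"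
        using move[of ks "replicate (length ls) 1" a "b * prod_list ls"] Cons.prems by simp
      finally show ?case by simp
    qed simp
    have "t (E ks) = t (E (prod_list ks # replicate (n - 1) 1))" if "length ks = Suc (n - 1)" for ks
      using that collect[of "[]" "tl ks" "hd ks"] Suc by (cases ks) auto
    moreover have "t \<in> Vn (Suc (n - 1))" using t Suc by simp
    ultimately show "t \<in> Vn (Suc (n - 1)) \<and>
        (\<forall>ks. length ks = Suc (n - 1) \<longrightarrow> t (E ks) = t (E (prod_list ks # replicate (n - 1) 1)))"
      by blast
  next
    assume h: "t \<in> Vn (Suc (n - 1)) \<and>
        (\<forall>ks. length ks = Suc (n - 1) \<longrightarrow> t (E ks) = t (E (prod_list ks # replicate (n - 1) 1)))"
    have t: "t \<in> Vn n" using conjunct1[OF h] Suc by simp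
    have prod: "t (E ks) = t (E (prod_list ks # replicate (n - 1) 1))" if "length ks = n" for ks
      using conjunct2[OF h, rule_format, of ks] that Suc by simp
    have "?ap i (comult C) t = ?ap (Suc i) (comult C) t" if i: "Suc i < n" for i
    proof (rule Vn_eqI[where n = "Suc n"])
      fix ks :: "'d list" assume len: "length ks = Suc n"
      obtain ps a b c ls where ks: "ks = ps @ a # b # c # ls" and ps: "length ps = i"
      proof
        have "drop i ks = ks ! i # ks ! Suc i # ks ! Suc (Suc i) # drop (Suc (Suc (Suc i))) ks"
          using i len by (simp add: Cons_nth_drop_Suc)
        then show "ks = take i ks @ ks ! i # ks ! Suc i # ks ! Suc (Suc i) # drop (Suc (Suc (Suc i))) ks"
          by (metis append_take_drop_id)
        show "length (take i ks) = i" using i len by simp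
      qed
      have "?ap (length ps) (comult C) t (E (ps @ a # b # c # ls)) = t (E (ps @ (a * b) # c # ls))"
        using len ks by (intro apply_comult_eval[OF t]) simp
      moreover have "?ap (length (ps @ [a])) (comult C) t (E ((ps @ [a]) @ b # c # ls)) =
          t (E ((ps @ [a]) @ (b * c) # ls))"
        using len ks by (intro apply_comult_eval[OF t]) simp
      moreover have "t (E (ps @ (a * b) # c # ls)) = t (E (ps @ a # (b * c) # ls))"
      proof -
        have "prod_list (ps @ (a * b) # c # ls) = prod_list (ps @ a # (b * c) # ls)"
          by (simp add: mult.assoc)
        then show ?thesis
          using prod[of "ps @ (a * b) # c # ls"] prod[of "ps @ a # (b * c) # ls"] len
          unfolding ks by (simp del: eval_form.simps)
      qed
      ultimately show "?ap i (comult C) t (E ks) = ?ap (Suc i) (comult C) t (E ks)"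
        by (simp add: ks ps)
    qed (use t i in \<open>auto intro!: apply_comult_in simp del: replicate_Suc\<close>)
    with t Vn show "t \<in> cotensor_power C V (comult C) (comult C) n" by blast
  qed
qed

abbreviation "Cn n \<equiv> cotensor_power C V (comult C) (comult C) n"

lemma Cn_D:
  assumes "t \<in> Cn n"
  shows "t \<in> Vn (Suc (n - 1))"
    and "length ks = Suc (n - 1) \<Longrightarrow> t (E ks) = t (E (prod_list ks # replicate (n - 1) 1))"
  using assms cotensor_power_iff by blast+

lemma Cn_eqI:
  assumes "t \<in> Cn n" "u \<in> Cn n"
    and "\<And>a. t (E (a # replicate (n - 1) 1)) = u (E (a # replicate (n - 1) 1))"
  shows "t = u"
proof (rule Vn_eqI[OF Cn_D(1)[OF assms(1)] Cn_D(1)[OF assms(2)]])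
  show "t (E ks) = u (E ks)" if "length ks = Suc (n - 1)" for ks
    unfolding Cn_D(2)[OF assms(1) that] Cn_D(2)[OF assms(2) that] by (rule assms(3))
qed

lemma subspace_Cn: "fs.subspace (Cn n)"
proof (rule fs.subspaceI)
  note sub = subspace_tensor_space[of "scal C" "replicate (Suc (n - 1)) V"]
  show "0 \<in> Cn n" unfolding cotensor_power_iff using fs.subspace_0[OF sub] by (simp add: pointwise)
  fix t u c
  assume t: "t \<in> Cn n"
  show "fscale c t \<in> Cn n"
    unfolding cotensor_power_iff
  proof (intro conjI allI impI)
    show "fscale c t \<in> Vn (Suc (n - 1))" by (rule fs.subspace_scale[OF sub Cn_D(1)[OF t]])
    show "fscale c t (E ks) = fscale c t (E (prod_list ks # replicate (n - 1) 1))"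
      if "length ks = Suc (n - 1)" for ks
      by (simp only: fscale_apply Cn_D(2)[OF t that])
  qed
  assume u: "u \<in> Cn n"
  show "t + u \<in> Cn n"
    unfolding cotensor_power_iff
  proof (intro conjI allI impI)
    show "t + u \<in> Vn (Suc (n - 1))" by (rule fs.subspace_add[OF sub Cn_D(1)[OF t] Cn_D(1)[OF u]])
    show "(t + u) (E ks) = (t + u) (E (prod_list ks # replicate (n - 1) 1))"
      if "length ks = Suc (n - 1)" for ks
      by (simp only: plus_fun_apply Cn_D(2)[OF t that] Cn_D(2)[OF u that])
  qed
qed

lemma slot_form:
  assumes "t \<in> Vn (Suc n)"
  shows "(\<lambda>a. t (E (a # ks))) \<in> V"
  using assms
proof (induction rule: tensor_space_induct)
  case zero
  have "(\<lambda>a :: 'd. 0 :: 'k) = 0" by (simp add: fun_eq_iff pointwise)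
  then show ?case using dual.subspace_0[OF dual.subspace_V] by (simp add: pointwise)
next
  case (step c ws t)
  then obtain f vs where ws: "ws = f # vs" and f: "f \<in> V" by (auto simp: set_Cons_def)
  have "(\<lambda>a. (fscale c (pure_tensor (scal C) ws) + t) (E (a # ks))) =
      scal C (c * E ks vs) f + (\<lambda>a. t (E (a # ks)))"
    using E_form[of "_ # ks"] unfolding dual_scal ws by (simp add: pure_tensor_def pointwise fun_eq_iff algebra_simps)
  then show ?case using step f by (simp add: dual.subspace_add dual.subspace_scale dual.subspace_V)
qed

text \<open>
  The tensor is the iterated comultiplication of \<open>f\<close>. Its value at a word is \<open>f\<close> of the product of
  the letters, which is what the cotensor condition asks for.
\<close>

lemma Cn_exists:
  assumes f: "f \<in> V"
  shows "\<exists>t \<in> Cn n. \<forall>a. t (E (a # replicate (n - 1) 1)) = f a"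
proof -
  have "\<exists>t \<in> Vn (Suc m). \<forall>ks. length ks = Suc m \<longrightarrow> t (E ks) = f (prod_list ks)" for m
  proof (induction m)
    case 0
    have "pure_tensor (scal C) [f] \<in> Vn (Suc 0)"
      using f by (intro pure_in_tensor_space) (simp add: set_Cons_def)
    moreover have "pure_tensor (scal C) [f] (E [a]) = f a" for a
      using E_form[of "[a]"] by (simp add: pure_tensor_def)
    ultimately show ?case by (intro bexI[of _ "pure_tensor (scal C) [f]"]) (auto simp: length_Suc_conv)
  next
    case (Suc m)
    then obtain t where t: "t \<in> Vn (Suc m)" "\<And>ks. length ks = Suc m \<Longrightarrow> t (E ks) = f (prod_list ks)" by blast
    let ?u = "apply_at (scal C) (replicate (Suc m) V) 0 (comult C) t"
    have "?u (E ks) = f (prod_list ks)" if ks: "length ks = Suc (Suc m)" for ks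
    proof -
      obtain a b ls where "ks = a # b # ls" "length ls = m" using ks by (auto simp: length_Suc_conv)
      then show ?thesis
        using apply_comult_eval[OF t(1), of "[]" ls a b] t(2)[of "(a * b) # ls"]
        by (simp add: mult.assoc del: eval_form.simps)
    qed
    then show ?case using apply_comult_in[OF t(1), of 0] by blast
  qed
  then obtain t where t: "t \<in> Vn (Suc (n - 1))"
    and val: "\<And>ks. length ks = Suc (n - 1) \<Longrightarrow> t (E ks) = f (prod_list ks)" by blast
  have val1: "t (E (a # replicate (n - 1) 1)) = f a" for a
    using val[of "a # replicate (n - 1) 1"] by simp
  have "t \<in> Cn n" unfolding cotensor_power_iff using t val val1 by simp
  then show ?thesis using val1 by blast
qed

end

section \<open>The comultiplication of the cotensor coalgebra\<close>

lemma dsum_in_add: "dsum_in n (t + u) = dsum_in n t + dsum_in n u"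
  and dsum_in_times: "dsum_in n (fscale c t) = dsum_scale c (dsum_in n t)"
  by (auto simp: dsum_in_def dsum_scale_def fun_eq_iff pointwise)

lemma vector_space_dsum_scale: "vector_space dsum_scale"
  by unfold_locales (auto simp: dsum_scale_def fun_eq_iff pointwise algebra_simps)

definition direct_sum :: "(nat \<Rightarrow> ('v, 'k::field) tensor set) \<Rightarrow> (nat \<Rightarrow> ('v, 'k) tensor) set" where
  "direct_sum W = {F. finite {n. F n \<noteq> 0} \<and> (\<forall>n. F n \<in> W n)}"

lemma subspace_direct_sum:
  assumes "\<And>n. fs.subspace (W n)"
  shows "module.subspace dsum_scale (direct_sum W)"
proof -
  interpret D: vector_space dsum_scale by (rule vector_space_dsum_scale)
  show ?thesis
  proof (rule D.subspaceI)
    show "0 \<in> direct_sum W"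
      using fs.subspace_0[OF assms] by (simp add: direct_sum_def zero_fun_apply)
    fix F G c
    assume F: "F \<in> direct_sum W"
    have "{n. dsum_scale c F n \<noteq> 0} \<subseteq> {n. F n \<noteq> 0}" by (auto simp: dsum_scale_def)
    then show "dsum_scale c F \<in> direct_sum W"
      using F fs.subspace_scale[OF assms]
      by (auto simp: direct_sum_def dsum_scale_def intro: finite_subset)
    assume G: "G \<in> direct_sum W"
    have "{n. (F + G) n \<noteq> 0} \<subseteq> {n. F n \<noteq> 0} \<union> {n. G n \<noteq> 0}" by (auto simp: plus_fun_apply)
    then have "finite {n. (F + G) n \<noteq> 0}"
      using F G by (auto simp: direct_sum_def intro: finite_subset)
    moreover have "(F + G) n \<in> W n" for n
      using F G fs.subspace_add[OF assms] by (simp add: direct_sum_def plus_fun_apply)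
    ultimately show "F + G \<in> direct_sum W" by (simp add: direct_sum_def)
  qed
qed

lemma dsum_in_direct_sum:
  assumes "\<And>m. fs.subspace (W m)" "t \<in> W n"
  shows "dsum_in n t \<in> direct_sum W"
proof -
  have "{m. dsum_in n t m \<noteq> 0} \<subseteq> {n}" by (auto simp: dsum_in_def)
  then show ?thesis
    using assms(2) fs.subspace_0[OF assms(1)]
    by (auto simp: direct_sum_def dsum_in_def intro: finite_subset)
qed

context finite_dimensional_algebra
begin

abbreviation "DC \<equiv> DC_id scale"

lemma DC_carr: "carr DC = direct_sum Cn"
  and DC_scal: "scal DC = dsum_scale"
  and DC_comult: "comult DC F = (\<Sum>n | F n \<noteq> 0. cotensor_comult_hom C V (comult C) (comult C) n (F n))"
  and DC_counit: "counit DC F = counit C (THE c. c \<in> V \<and> F 0 = pure_tensor (scal C) [c])"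
  by (simp_all add: DC_id_def Let_def cotensor_coalg_def direct_sum_def)

text \<open>The multiplication of homogeneous elements \<open>a * x^m\<close> of \<open>D[[x]]\<close>, encoded as \<open>(m, a)\<close>.\<close>

definition hom_mult :: "nat \<times> 'd \<Rightarrow> nat \<times> 'd \<Rightarrow> nat \<times> 'd" where
  "hom_mult m n = (fst m + fst n, snd m * snd n)"

definition word_eval :: "nat \<times> 'd list \<Rightarrow> (nat \<Rightarrow> ('d \<Rightarrow> 'k, 'k) tensor) \<Rightarrow> 'k" where
  "word_eval w F = F (fst w) (E (snd w))"

text \<open>
  One letter followed by ones: on a cotensor power, where only the product of the letters counts,
  this loses no information.
\<close>

definition hom_eval :: "nat \<times> 'd \<Rightarrow> (nat \<Rightarrow> ('d \<Rightarrow> 'k, 'k) tensor) \<Rightarrow> 'k" where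
  "hom_eval m F = F (fst m) (E (snd m # replicate (fst m - 1) 1))"

text \<open>
  Degrees 0 and 1 both consist of words of length one, and \<open>Suc (n - 1)\<close> is the length of the words
  in degree \<open>n\<close> for all \<open>n\<close>.
\<close>

definition words :: "(nat \<times> 'd list) set" where
  "words = {(n, ks). length ks = Suc (n - 1)}"

abbreviation "V_seq \<equiv> direct_sum (\<lambda>n. Vn (Suc (n - 1)))"

lemma word_evaluations: "evaluations dsum_scale V_seq words word_eval"
proof -
  interpret D: vector_space dsum_scale by (rule vector_space_dsum_scale)
  show ?thesis
  proof unfold_locales
    show "D.subspace V_seq" by (rule subspace_direct_sum) (rule subspace_tensor_space)
    fix F :: "nat \<Rightarrow> ('d \<Rightarrow> 'k, 'k) tensor"
    assume F: "F \<in> V_seq" and zero: "\<And>w. w \<in> words \<Longrightarrow> word_eval w F = 0"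
    have "F n = 0" for n
    proof (rule Vn_eqI[where n = "Suc (n - 1)"])
      show "F n \<in> Vn (Suc (n - 1))" using F by (simp add: direct_sum_def)
      show "0 \<in> Vn (Suc (n - 1))" by (rule fs.subspace_0[OF subspace_tensor_space])
      show "F n (E ks) = 0 (E ks)" if "length ks = Suc (n - 1)" for ks
        using zero[of "(n, ks)"] that by (simp add: words_def word_eval_def pointwise)
    qed
    then show "F = 0" by (simp add: fun_eq_iff zero_fun_apply)
  qed (auto simp: word_eval_def dsum_scale_def pointwise)
qed

sublocale word: evaluations dsum_scale V_seq words word_eval
  by (rule word_evaluations)

lemma DC_subset: "carr DC \<subseteq> V_seq"
  unfolding DC_carr direct_sum_def using Cn_D(1) by blast

lemma word_eval_DC:
  assumes "F \<in> carr DC" "(n, ks) \<in> words"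
  shows "word_eval (n, ks) F = hom_eval (n, prod_list ks) F"
proof -
  have "F n \<in> Cn n" using assms(1) by (simp add: DC_carr direct_sum_def)
  from Cn_D(2)[OF this, of ks] assms(2) show ?thesis
    by (simp add: words_def word_eval_def hom_eval_def)
qed

lemma hom_evaluations: "evaluations dsum_scale (carr DC) UNIV hom_eval"
proof unfold_locales
  show "word.subspace (carr DC)" unfolding DC_carr by (rule subspace_direct_sum) (rule subspace_Cn)
  fix F
  assume F: "F \<in> carr DC" and zero: "\<And>m. m \<in> UNIV \<Longrightarrow> hom_eval m F = 0"
  show "F = 0"
  proof (rule word.eval_separates)
    show "F \<in> V_seq" using F DC_subset by blast
    show "word_eval w F = 0" if "w \<in> words" for w
      using word_eval_DC[OF F] that zero by (cases w) auto
  qed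
qed (auto simp: hom_eval_def dsum_scale_def pointwise)

sublocale hom: evaluations dsum_scale "carr DC" UNIV hom_eval
  by (rule hom_evaluations)

context
  fixes t m j p q
  assumes t: "t \<in> Vn m" and j: "j = Suc (p - 1)" and m: "m = j + Suc (q - 1)"
begin

abbreviation (input) "split_word \<equiv> (\<lambda>ws. pure_tensor dsum_scale
     [dsum_in p (pure_tensor (scal C) (take j ws)), dsum_in q (pure_tensor (scal C) (drop j ws))])"

lemma multilinear_split_word: "multilinear_on (scal C) (replicate m V) split_word"
proof (rule multilinear_onI)
  fix us vs x y c
  show "split_word (us @ (x + y) # vs) = split_word (us @ x # vs) + split_word (us @ y # vs)"
  proof (cases "length us < j")
    case True
    then obtain i where "j = length us + Suc i" using less_imp_Suc_add by fastforce
    then show ?thesis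
      using pure_tensor_add[of dsum_scale "[]" _ _ "[_]"] by (simp add: pure_tensor_add dsum_in_add)
  next
    case False
    then show ?thesis
      using pure_tensor_add[of dsum_scale "[_]" _ _ "[]"] by (simp add: pure_tensor_add dsum_in_add)
  qed
  show "split_word (us @ scal C c x # vs) = fscale c (split_word (us @ x # vs))"
  proof (cases "length us < j")
    case True
    then obtain i where "j = length us + Suc i" using less_imp_Suc_add by fastforce
    then show ?thesis
      using pure_tensor_times[of dsum_scale "[]" _ _ "[_]"] by (simp add: pure_tensor_times dsum_in_times)
  next
    case False
    then show ?thesis
      using pure_tensor_times[of dsum_scale "[_]" _ _ "[]"] by (simp add: pure_tensor_times dsum_in_times)
  qed
qed

lemma tensor_split_in: "tensor_split (scal C) (replicate m V) j p q t \<in> tensor_space dsum_scale [V_seq, V_seq]"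
  unfolding tensor_split_def
proof (rule tensor_lift_in_subspace[OF dual.vector_space_axioms subspace_Vn multilinear_split_word
      subspace_tensor_space _ t])
  fix ws assume ws: "ws \<in> listset (replicate m V)"
  have "dsum_in p (pure_tensor (scal C) (take j ws)) \<in> V_seq"
    "dsum_in q (pure_tensor (scal C) (drop j ws)) \<in> V_seq"
    using ws j m by (intro dsum_in_direct_sum subspace_tensor_space pure_in_tensor_space; auto simp: listset_iff simp del: replicate_Suc)+
  then show "split_word ws \<in> tensor_space dsum_scale [V_seq, V_seq]"
    by (intro pure_in_tensor_space) (simp add: set_Cons_def)
qed

lemma tensor_split_eval:
  assumes "(p', ks) \<in> words" "(q', ls) \<in> words"
  shows "tensor_split (scal C) (replicate m V) j p q t (eval_form word_eval [(p', ks), (q', ls)]) =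
    (if p' = p \<and> q' = q then t (E (ks @ ls)) else 0)"
proof -
  let ?\<gamma> = "\<lambda>ws. (if p' = p \<and> q' = q then 1 else 0) * E (ks @ ls) ws"
  have "tensor_split (scal C) (replicate m V) j p q t (eval_form word_eval [(p', ks), (q', ls)]) = t ?\<gamma>"
    unfolding tensor_split_def
  proof (rule tensor_lift_eval[OF dual.vector_space_axioms subspace_Vn multilinear_split_word _ _ t])
    show "multilinear_form (scal C) ?\<gamma>" by (intro multilinear_form_times E_form)
    fix ws assume "ws \<in> listset (replicate m V)"
    have "multilinear_form dsum_scale (eval_form word_eval [(p', ks), (q', ls)])"
      using assms by (intro word.multilinear_eval) simp
    moreover have "E (ks @ ls) ws = E ks (take j ws) * E ls (drop j ws)" if "p' = p"
      using assms(1) that j by (simp add: eval_form_append words_def)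
    ultimately show "split_word ws (eval_form word_eval [(p', ks), (q', ls)]) = ?\<gamma> ws"
      using E_form by (auto simp: pure_tensor_def word_eval_def dsum_in_def pointwise)
  qed
  also have "\<dots> = (if p' = p \<and> q' = q then t (E (ks @ ls)) else 0)"
    unfolding tensor_form_times[OF t E_form] by simp
  finally show ?thesis .
qed

end

text \<open>
  In every degree \<open>n\<close> the comultiplication is the sum over all ways to cut \<open>n = p + q\<close>, the extreme
  terms being created by the coactions. Two words of degrees \<open>p\<close> and \<open>q\<close> only see the cut with
  these degrees, and there a tensor in the cotensor power takes its value at the product of all
  letters.
\<close>

lemma comult_hom:
  assumes t: "t \<in> Cn n"
  shows "cotensor_comult_hom C V (comult C) (comult C) n t \<in> tensor_space dsum_scale [V_seq, V_seq]"
    and "(p, ks) \<in> words \<Longrightarrow> (q, ls) \<in> words \<Longrightarrow>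
      cotensor_comult_hom C V (comult C) (comult C) n t (eval_form word_eval [(p, ks), (q, ls)]) =
      (if p + q = n then t (E (prod_list ks * prod_list ls # replicate (n - 1) 1)) else 0)"
proof -
  let ?split = "tensor_split (scal C)"
  let ?hom = "cotensor_comult_hom C V (comult C) (comult C) n t"
  let ?ev = "eval_form word_eval [(p, ks), (q, ls)]"
  have t': "t \<in> Vn (Suc (n - 1))" by (rule Cn_D(1)[OF t])
  have val: "t (E ks') = t (E (prod_list ks' # replicate (n - 1) 1))" if "length ks' = Suc (n - 1)" for ks'
    by (rule Cn_D(2)[OF t that])
  have "?hom \<in> tensor_space dsum_scale [V_seq, V_seq] \<and>
    ((p, ks) \<in> words \<longrightarrow> (q, ls) \<in> words \<longrightarrow>
      ?hom ?ev = (if p + q = n then t (E (prod_list ks * prod_list ls # replicate (n - 1) 1)) else 0))"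
  proof (cases n)
    case 0
    let ?u = "apply_at (scal C) [V] 0 (comult C) t"
    have u: "?u \<in> Vn 2" using apply_comult_in[of t 1 0] t' 0 by (simp add: numeral_2_eq_2)
    have u_eval: "?u (E [a, b]) = t (E [a * b])" for a b
      using apply_comult_eval[of t 1 "[]" "[]" a b] t' 0 by simp
    have hom: "?hom = ?split (replicate 2 V) 1 0 0 ?u"
      by (simp add: cotensor_comult_hom_def Let_def 0 numeral_2_eq_2)
    have "?hom \<in> tensor_space dsum_scale [V_seq, V_seq]"
      unfolding hom by (rule tensor_split_in[OF u]) auto
    moreover have "?hom ?ev = (if p + q = n then t (E (prod_list ks * prod_list ls # replicate (n - 1) 1)) else 0)"
      if w: "(p, ks) \<in> words" "(q, ls) \<in> words"
    proof -
      have "?hom ?ev = (if p = 0 \<and> q = 0 then ?u (E (ks @ ls)) else 0)"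
        unfolding hom by (rule tensor_split_eval[OF u _ _ w]) auto
      moreover have "?u (E (ks @ ls)) = t (E [prod_list ks * prod_list ls])" if "p = 0" "q = 0"
      proof -
        have "length ks = Suc 0" "length ls = Suc 0" using w that by (simp_all add: words_def)
        then obtain a b where "ks = [a]" "ls = [b]" by (auto simp: length_Suc_conv)
        then show ?thesis using u_eval[of a b] by (simp del: eval_form.simps)
      qed
      ultimately show ?thesis using 0 by (simp del: eval_form.simps)
    qed
    ultimately show ?thesis by blast
  next
    case (Suc r)
    have t: "t \<in> Vn n" using t' Suc by simp
    let ?l = "apply_at (scal C) (replicate n V) 0 (comult C) t"
    let ?r = "apply_at (scal C) (replicate n V) (n - 1) (comult C) t"
    let ?val = "t (E (prod_list ks * prod_list ls # replicate (n - 1) 1))"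
    have l: "?l \<in> Vn (Suc n)" and r: "?r \<in> Vn (Suc n)"
      by (rule apply_comult_in[OF t], use Suc in linarith)+
    have hom: "?hom = ?split (replicate (Suc n) V) 1 0 n ?l
        + (\<Sum>i = 1..<n. ?split (replicate n V) i i (n - i) t)
        + ?split (replicate (Suc n) V) n n 0 ?r"
      using Suc by (simp add: cotensor_comult_hom_def Let_def replicate_append_same)
    have in1: "?split (replicate (Suc n) V) 1 0 n ?l \<in> tensor_space dsum_scale [V_seq, V_seq]"
      using Suc by (intro tensor_split_in[OF l]) auto
    have in2: "?split (replicate n V) i i (n - i) t \<in> tensor_space dsum_scale [V_seq, V_seq]"
      if "i \<in> {1..<n}" for i
      using that by (intro tensor_split_in[OF t]) auto
    have in3: "?split (replicate (Suc n) V) n n 0 ?r \<in> tensor_space dsum_scale [V_seq, V_seq]"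
      using Suc by (intro tensor_split_in[OF r]) auto
    have "?hom \<in> tensor_space dsum_scale [V_seq, V_seq]"
      unfolding hom using in1 in2 in3
      by (intro fs.subspace_add fs.subspace_sum subspace_tensor_space)
    moreover have "?hom ?ev = (if p + q = n then ?val else 0)"
      if w: "(p, ks) \<in> words" "(q, ls) \<in> words"
    proof -
      have e1: "?split (replicate (Suc n) V) 1 0 n ?l ?ev = (if p = 0 \<and> q = n then ?val else 0)"
      proof -
        have "?l (E (ks @ ls)) = ?val" if "p = 0" "q = n"
        proof -
          have "length ks = Suc 0" "length ls = Suc (n - 1)" using w that by (simp_all add: words_def)
          then obtain a b ls' where k: "ks = [a]" "ls = b # ls'" "length ls' = n - 1"
            by (auto simp: length_Suc_conv)
          have "?l (E (ks @ ls)) = t (E (a * b # ls'))"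
            using apply_comult_eval[OF t, of "[]" ls' a b] k Suc by simp
          also have "\<dots> = ?val" using val[of "a * b # ls'"] k Suc by (simp add: mult.assoc del: eval_form.simps)
          finally show ?thesis .
        qed
        then show ?thesis
          by (subst tensor_split_eval[OF l _ _ w]) (use Suc in auto)
      qed
      have e2: "?split (replicate n V) i i (n - i) t ?ev = (if p = i \<and> q = n - i then ?val else 0)"
        if i: "i \<in> {1..<n}" for i
      proof -
        have "t (E (ks @ ls)) = ?val" if "p = i" "q = n - i"
          using val[of "ks @ ls"] w that i by (simp add: words_def del: eval_form.simps)
        then show ?thesis
          by (subst tensor_split_eval[OF t _ _ w]) (use i in auto)
      qed
      have e3: "?split (replicate (Suc n) V) n n 0 ?r ?ev = (if p = n \<and> q = 0 then ?val else 0)"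
      proof -
        have "?r (E (ks @ ls)) = ?val" if "p = n" "q = 0"
        proof -
          have "length ks = Suc (n - 1)" "length ls = Suc 0" using w that by (simp_all add: words_def)
          then obtain ks' a b where k: "ks = ks' @ [a]" "ls = [b]" "length ks' = n - 1"
            by (cases ks rule: rev_cases) (auto simp: length_Suc_conv)
          have "?r (E (ks @ ls)) = t (E (ks' @ [a * b]))"
            using apply_comult_eval[OF t, of ks' "[]" a b] k Suc by simp
          also have "\<dots> = ?val" using val[of "ks' @ [a * b]"] k Suc by (simp add: mult.assoc del: eval_form.simps)
          finally show ?thesis .
        qed
        then show ?thesis
          by (subst tensor_split_eval[OF r _ _ w]) (use Suc in auto)
      qed
      have "(\<Sum>i = 1..<n. ?split (replicate n V) i i (n - i) t ?ev) =
          (\<Sum>i = 1..<n. if i = p then (if q = n - p then ?val else 0) else 0)"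
        by (intro sum.cong refl, subst e2) auto
      also have "\<dots> = (if p \<in> {1..<n} \<and> q = n - p then ?val else 0)" by (simp add: sum.delta)
      finally show ?thesis
        unfolding hom plus_fun_apply sum_fun_apply e1 e3 using Suc by auto
    qed
    ultimately show ?thesis by blast
  qed
  then show "?hom \<in> tensor_space dsum_scale [V_seq, V_seq]"
    and "(p, ks) \<in> words \<Longrightarrow> (q, ls) \<in> words \<Longrightarrow>
      ?hom ?ev = (if p + q = n then t (E (prod_list ks * prod_list ls # replicate (n - 1) 1)) else 0)"
    by blast+
qed

lemma DC_comult_word_eval:
  assumes F: "F \<in> carr DC"
  shows "comult DC F \<in> tensor_space dsum_scale [V_seq, V_seq]"
    and "(p, ks) \<in> words \<Longrightarrow> (q, ls) \<in> words \<Longrightarrow>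
      comult DC F (eval_form word_eval [(p, ks), (q, ls)]) =
      hom_eval (hom_mult (p, prod_list ks) (q, prod_list ls)) F"
proof -
  have F: "finite {n. F n \<noteq> 0}" "\<And>n. F n \<in> Cn n" using F by (auto simp: DC_carr direct_sum_def)
  show "comult DC F \<in> tensor_space dsum_scale [V_seq, V_seq]"
    unfolding DC_comult by (intro fs.subspace_sum subspace_tensor_space comult_hom(1) F)
  assume w: "(p, ks) \<in> words" "(q, ls) \<in> words"
  have "comult DC F (eval_form word_eval [(p, ks), (q, ls)]) =
      (\<Sum>n | F n \<noteq> 0. if n = p + q then F n (E (prod_list ks * prod_list ls # replicate (n - 1) 1)) else 0)"
    unfolding DC_comult sum_fun_apply by (intro sum.cong refl, subst comult_hom(2)[OF F(2) w]) auto
  also have "\<dots> = F (p + q) (E (prod_list ks * prod_list ls # replicate (p + q - 1) 1))"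
    using F(1) by (simp add: sum.delta pointwise del: eval_form.simps)
  finally show "comult DC F (eval_form word_eval [(p, ks), (q, ls)]) =
      hom_eval (hom_mult (p, prod_list ks) (q, prod_list ls)) F"
    by (simp add: hom_eval_def hom_mult_def)
qed

lemma DC_counit_eval:
  assumes F: "F \<in> carr DC"
  shows "counit DC F = hom_eval (0, 1) F"
proof -
  have "F 0 \<in> Cn 0" using F by (simp add: DC_carr direct_sum_def)
  from Cn_D(1)[OF this] have F0: "F 0 \<in> Vn (Suc 0)" by simp
  let ?f = "\<lambda>a. F 0 (E [a])"
  have f: "?f \<in> V" using slot_form[OF F0, of "[]"] by simp
  have pure: "pure_tensor (scal C) [c] (E [a]) = c a" for c a
    using E_form[of "[a]"] by (simp add: pure_tensor_def)
  have "F 0 = pure_tensor (scal C) [?f]"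
  proof (rule Vn_eqI[OF F0])
    show "pure_tensor (scal C) [?f] \<in> Vn (Suc 0)"
      using f by (intro pure_in_tensor_space) (simp add: set_Cons_def)
    show "F 0 (E ks) = pure_tensor (scal C) [?f] (E ks)" if "length ks = Suc 0" for ks
      using that by (auto simp: length_Suc_conv pure simp del: eval_form.simps)
  qed
  moreover have "c = ?f" if "F 0 = pure_tensor (scal C) [c]" for c
    using that pure by auto
  ultimately have "(THE c. c \<in> V \<and> F 0 = pure_tensor (scal C) [c]) = ?f"
    using f by (intro the_equality) blast+
  then show ?thesis using f by (simp add: DC_counit dual.counit_eval hom_eval_def del: eval_form.simps)
qed

end

section \<open>The finite dual of the power series ring\<close>

lemma eval_form_map: "eval_form (\<lambda>m. e (g m)) ms = eval_form e (map g ms)"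
proof
  show "eval_form (\<lambda>m. e (g m)) ms ws = eval_form e (map g ms) ws" for ws
    by (induction "\<lambda>m. e (g m)" ms ws rule: eval_form.induct) auto
qed

context finite_dimensional_algebra
begin

abbreviation "power_series_scale \<equiv> fps_scale scale"

lemma fps_scale_nth [simp]: "fps_nth (power_series_scale c f) n = scale c (fps_nth f n)"
  by (simp add: fps_scale_def)

lemma algebra_scale_fps: "algebra_scale power_series_scale"
proof -
  have s: "scale c (x * y) = scale c x * y" "scale c (x * y) = x * scale c y" for c x y
    using algebra_scale unfolding algebra_scale_def by blast+
  have "vector_space power_series_scale"
    by unfold_locales (auto simp: fps_eq_iff scale_right_distrib scale_left_distrib)
  moreover have "power_series_scale c (f * g) = power_series_scale c f * g" for c f g
    by (auto simp: fps_eq_iff fps_mult_nth scale_sum_right s(1))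
  moreover have "power_series_scale c (f * g) = f * power_series_scale c g" for c f g
    by (auto simp: fps_eq_iff fps_mult_nth scale_sum_right s(2))
  ultimately show ?thesis by (simp add: algebra_scale_def)
qed

sublocale fps: vector_space power_series_scale
  using algebra_scale_fps by (simp add: algebra_scale_def)

definition monom :: "nat \<times> 'd \<Rightarrow> 'd fps" where
  "monom m = fps_const (snd m) * fps_X ^ fst m"

lemma monom_nth: "fps_nth (monom (n, a)) m = (if m = n then a else 0)"
  by (simp add: monom_def)

lemma monom_mult: "monom (hom_mult m n) = monom m * monom n"
proof -
  obtain i a j b where mn: "m = (i, a)" "n = (j, b)" by (metis surj_pair)
  have "fps_const a * fps_X ^ i * (fps_const b * fps_X ^ j)
      = fps_const a * (fps_X ^ i * fps_const b) * fps_X ^ j" by (simp only: mult.assoc)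
  also have "fps_X ^ i * fps_const b = fps_const b * fps_X ^ i"
    by (rule fps_mult_fps_X_power_commute)
  finally have "fps_const a * fps_X ^ i * (fps_const b * fps_X ^ j)
      = fps_const a * fps_const b * (fps_X ^ i * fps_X ^ j)" by (simp only: mult.assoc)
  then show ?thesis by (simp add: mn monom_def hom_mult_def power_add fps_const_mult)
qed

definition tail :: "nat \<Rightarrow> 'd fps set" where
  "tail N = {f. \<forall>n<N. fps_nth f n = 0}"

lemma two_sided_ideal_tail: "two_sided_ideal (tail N)"
  by (auto simp: two_sided_ideal_def tail_def fps_mult_nth intro!: sum.neutral)

lemma tail_decomposition: "g - (\<Sum>n<N. monom (n, fps_nth g n)) \<in> tail N"
  by (auto simp: tail_def fps_sum_nth monom_nth)

lemma finite_codim_tail: "finite_codim power_series_scale (tail N)"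
proof -
  let ?S = "monom ` ({..<N} \<times> Basis)"
  have monom: "monom (n, a) \<in> fps.span (?S \<union> tail N)" if "n < N" for n a
  proof -
    have "a \<in> span Basis" by (simp add: span_Basis)
    then show ?thesis
    proof (induction rule: span_induct_alt)
      case base
      have "monom (n, 0) = 0" by (simp add: fps_eq_iff monom_nth)
      then show ?case by (simp add: fps.span_zero)
    next
      case (step c b a)
      have "monom (n, b) \<in> fps.span (?S \<union> tail N)"
        using step(1) that by (intro fps.span_base UnI1 imageI) simp
      moreover have "monom (n, scale c b + a) = power_series_scale c (monom (n, b)) + monom (n, a)"
        by (simp add: fps_eq_iff monom_nth)
      ultimately show ?case using step(2) by (simp add: fps.span_add fps.span_scale)
    qed
  qed
  have "g \<in> fps.span (?S \<union> tail N)" for g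
  proof -
    have "g - (\<Sum>n<N. monom (n, fps_nth g n)) \<in> fps.span (?S \<union> tail N)"
      using tail_decomposition by (intro fps.span_base) blast
    moreover have "(\<Sum>n<N. monom (n, fps_nth g n)) \<in> fps.span (?S \<union> tail N)"
      by (intro fps.span_sum monom) simp
    ultimately show ?thesis using fps.span_add by fastforce
  qed
  then show ?thesis unfolding finite_codim_def using finite_Basis by (intro exI[of _ ?S]) auto
qed

lemma annihilator_tail_mono: "M \<le> N \<Longrightarrow>
  annihilator power_series_scale (tail M) \<subseteq> annihilator power_series_scale (tail N)"
  by (auto simp: annihilator_def tail_def)

text \<open>Modulo a tail every series is a finite sum of monomials.\<close>

lemma annihilator_tail_eq_0:
  assumes f: "f \<in> annihilator power_series_scale (tail N)" and zero: "\<And>m. f (monom m) = 0"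
  shows "f = 0"
proof
  fix g
  have add: "f (x + y) = f x + f y" for x y
    using f linear_dual_iff[OF fps.vector_space_axioms] by (simp add: annihilator_def)
  have "f 0 = 0" using add[of 0 0] by (metis add_0_right add_left_imp_eq)
  then have "f (\<Sum>n<M. monom (n, fps_nth g n)) = 0" for M
    by (induction M) (simp_all add: add zero)
  moreover have "f (g - (\<Sum>n<N. monom (n, fps_nth g n))) = 0"
    using f tail_decomposition by (simp add: annihilator_def)
  ultimately show "f g = 0 g"
    using add[of "g - (\<Sum>n<N. monom (n, fps_nth g n))" "\<Sum>n<N. monom (n, fps_nth g n)"]
    by (simp add: pointwise)
qed

end

locale division_algebra = finite_dimensional_algebra scale Basis
  for scale :: "'k::field \<Rightarrow> 'd::division_ring \<Rightarrow> 'd" and Basis :: "'d set"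
begin

text \<open>
  This is where division enters: the lowest coefficient of a nonzero series in an ideal is
  invertible, so the ideal contains a power of \<open>x\<close>.
\<close>

lemma tail_subset_ideal:
  assumes I: "two_sided_ideal I" and g: "g \<in> I" "g \<noteq> 0"
  shows "tail (subdegree g) \<subseteq> I"
proof
  let ?N = "subdegree g" and ?u = "fps_shift (subdegree g) g"
  fix h assume "h \<in> tail ?N"
  then have h: "h = fps_shift ?N h * fps_X ^ ?N"
    by (auto simp: fps_eq_iff tail_def fps_X_power_mult_right_nth)
  have "fps_nth ?u 0 \<noteq> 0" using g(2) by simp
  then have inv: "fps_left_inverse ?u (inverse (fps_nth ?u 0)) * ?u = 1"
    by (intro fps_left_inverse) simp
  have "fps_left_inverse ?u (inverse (fps_nth ?u 0)) * g
      = fps_left_inverse ?u (inverse (fps_nth ?u 0)) * (?u * fps_X ^ ?N)"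
    by (subst subdegree_decompose[of g]) (rule refl)
  also have "\<dots> = fps_X ^ ?N" by (simp only: mult.assoc[symmetric] inv mult_1_left)
  finally have "fps_X ^ ?N \<in> I" using I g(1) by (metis two_sided_ideal_def)
  then show "h \<in> I" using I h by (metis two_sided_ideal_def)
qed

text \<open>The powers of \<open>x\<close> are linearly independent, so the zero ideal has infinite codimension.\<close>

lemma nonzero_in_finite_codim:
  assumes "finite_codim power_series_scale I"
  shows "\<exists>g\<in>I. g \<noteq> 0"
proof (rule ccontr)
  assume "\<not> (\<exists>g\<in>I. g \<noteq> 0)"
  then have I: "I \<subseteq> {0}" by blast
  obtain S where S: "finite S" "fps.span (S \<union> I) = UNIV" using assms by (auto simp: finite_codim_def)
  have "fps.span (S \<union> I) \<subseteq> fps.span S"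
    using I by (intro fps.span_minimal) (auto intro: fps.span_base fps.span_zero)
  then have span: "fps.span S = UNIV" using S by auto
  let ?B = "(\<lambda>n. fps_X ^ n :: 'd fps) ` {..card S}"
  have inj: "inj_on (\<lambda>n. fps_X ^ n :: 'd fps) {..card S}"
    by (rule inj_onI) (metis fps_X_power_nth zero_neq_one)
  have "fps.independent ?B"
  proof
    assume "fps.dependent ?B"
    then obtain u v where v: "v \<in> ?B" "u v \<noteq> 0" and sum: "(\<Sum>w\<in>?B. power_series_scale (u w) w) = 0"
      by (subst (asm) fps.dependent_finite) auto
    obtain n where n: "v = fps_X ^ n" using v by blast
    have "(\<Sum>w\<in>?B. scale (u w) (fps_nth w n)) = scale (u v) (fps_nth v n)"
    proof (rule trans[OF sum.mono_neutral_right[where S = "{v}"]])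
      show "\<forall>w\<in>?B - {v}. scale (u w) (fps_nth w n) = 0" using n by auto
    qed (use v in auto)
    moreover have "(\<Sum>w\<in>?B. scale (u w) (fps_nth w n)) = 0"
      using arg_cong[OF sum, of "\<lambda>f. fps_nth f n"] by (simp add: fps_sum_nth)
    ultimately show False using v n by simp
  qed
  then have "card ?B \<le> card S" using fps.independent_span_bound[of S ?B] S span by simp
  then show False using card_image[OF inj] by simp
qed

abbreviation "A_dual \<equiv> finite_dual power_series_scale"
abbreviation "A_coalg \<equiv> finite_dual_coalg power_series_scale"

lemma finite_dual_eq: "A_dual = (\<Union>N. annihilator power_series_scale (tail N))"
proof (intro subset_antisym subsetI)
  fix f assume "f \<in> A_dual"
  then obtain I where f: "f \<in> linear_dual power_series_scale" "\<forall>x\<in>I. f x = 0"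
    and I: "two_sided_ideal I" "finite_codim power_series_scale I" by (auto simp: finite_dual_def)
  obtain g where "g \<in> I" "g \<noteq> 0" using nonzero_in_finite_codim[OF I(2)] by blast
  then have "f \<in> annihilator power_series_scale (tail (subdegree g))"
    using tail_subset_ideal[OF I(1)] f by (auto simp: annihilator_def)
  then show "f \<in> (\<Union>N. annihilator power_series_scale (tail N))" by blast
next
  fix f assume "f \<in> (\<Union>N. annihilator power_series_scale (tail N))"
  then show "f \<in> A_dual"
    using two_sided_ideal_tail finite_codim_tail by (auto simp: annihilator_def finite_dual_def)
qed

lemma subspace_finite_dual: "fs.subspace A_dual"
proof (rule fs.subspaceI)
  note sub = subspace_annihilator[OF fps.vector_space_axioms]
  show "0 \<in> A_dual" unfolding finite_dual_eq using fs.subspace_0[OF sub] by blast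
  fix f g c
  assume f: "f \<in> A_dual"
  then show "fscale c f \<in> A_dual" unfolding finite_dual_eq using fs.subspace_scale[OF sub] by blast
  assume "g \<in> A_dual"
  then obtain M N where "f \<in> annihilator power_series_scale (tail M)" "g \<in> annihilator power_series_scale (tail N)"
    using f finite_dual_eq by blast
  then have "f + g \<in> annihilator power_series_scale (tail (max M N))"
    using annihilator_tail_mono[of M "max M N"] annihilator_tail_mono[of N "max M N"]
    by (intro fs.subspace_add sub) auto
  then show "f + g \<in> A_dual" unfolding finite_dual_eq by blast
qed

lemma A_carr: "carr A_coalg = A_dual" and A_scal: "scal A_coalg = fscale"
  by (simp_all add: finite_dual_coalg_def dual_coalg_on_def)

lemma hom_mult_monoid: "monoid hom_mult (0, 1)"
  by unfold_locales (auto simp: hom_mult_def mult.assoc)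

lemma finite_dual_represented:
  "represented_coalgebra A_coalg (\<lambda>m f. f (monom m)) hom_mult (0, 1)"
proof -
  have ev: "evaluations (scal A_coalg) (carr A_coalg) UNIV (\<lambda>m f. f (monom m))"
    unfolding A_carr A_scal
  proof unfold_locales
    show "fs.subspace A_dual" by (rule subspace_finite_dual)
    show "f = 0" if "f \<in> A_dual" "\<And>m. m \<in> UNIV \<Longrightarrow> f (monom m) = 0" for f
      using that annihilator_tail_eq_0 unfolding finite_dual_eq by blast
  qed (auto simp: pointwise)
  have comult: "comult A_coalg f \<in> tensor_space fscale [A_dual, A_dual]
      \<and> comult A_coalg f (eval_form (\<lambda>m f. f (monom m)) [m, n]) = f (monom (hom_mult m n))"
    if f: "f \<in> A_dual" for f m n
  proof -
    obtain N where N: "f \<in> annihilator power_series_scale (tail N)" using f finite_dual_eq by blast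
    obtain t where t: "t \<in> tensor_space fscale [annihilator power_series_scale (tail N), annihilator power_series_scale (tail N)]"
      and val: "\<And>a b. t (eval_form (\<lambda>a f. f a) [a, b]) = f (a * b)"
      using annihilator_comult_exists[OF algebra_scale_fps two_sided_ideal_tail finite_codim_tail N] by blast
    have "annihilator power_series_scale (tail N) \<subseteq> A_dual" unfolding finite_dual_eq by blast
    then have t': "t \<in> tensor_space fscale [A_dual, A_dual]"
      using t by (intro subsetD[OF tensor_space_mono t]) (auto simp: set_Cons_def)
    have "comult A_coalg f = t"
      unfolding finite_dual_coalg_def by (rule dual_comult_eq[OF subspace_finite_dual t' val])
    then show ?thesis
      using t' val by (simp add: eval_form_map[of "\<lambda>a f. f a" monom] monom_mult del: eval_form.simps)
  qed
  interpret ev: evaluations "scal A_coalg" "carr A_coalg" UNIV "\<lambda>m f. f (monom m)" by (rule ev)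
  interpret M: monoid hom_mult "(0, 1)" by (rule hom_mult_monoid)
  show ?thesis
  proof unfold_locales
    show "counit A_coalg f = f (monom (0, 1))" for f
      by (simp add: finite_dual_coalg_def dual_coalg_on_def monom_def)
  qed (use comult in \<open>auto simp: A_carr A_scal simp del: eval_form.simps\<close>)
qed

sublocale A: represented_coalgebra A_coalg "\<lambda>m f. f (monom m)" hom_mult "(0, 1)"
  by (rule finite_dual_represented)

section \<open>The isomorphism\<close>

text \<open>
  Every summand sees a single coefficient of the series, and there are finitely many summands, so
  the form vanishes on a tail.
\<close>

definition series_form :: "(nat \<Rightarrow> ('d \<Rightarrow> 'k, 'k) tensor) \<Rightarrow> 'd fps \<Rightarrow> 'k" where
  "series_form F g = (\<Sum>n | F n \<noteq> 0. hom_eval (n, fps_nth g n) F)"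

lemma hom_eval_linear:
  assumes F: "F \<in> carr DC"
  shows "hom_eval (n, a + b) F = hom_eval (n, a) F + hom_eval (n, b) F"
    and "hom_eval (n, scale c a) F = c * hom_eval (n, a) F"
    and "hom_eval (n, 0) F = 0"
proof -
  have "F n \<in> Cn n" using F by (simp add: DC_carr direct_sum_def)
  from slot_form[OF Cn_D(1)[OF this], of "replicate (n - 1) 1"]
  have "(\<lambda>a. hom_eval (n, a) F) \<in> linear_dual scale"
    unfolding dual_carr annihilator_def hom_eval_def by simp
  then show lin: "hom_eval (n, a + b) F = hom_eval (n, a) F + hom_eval (n, b) F"
    "hom_eval (n, scale c a) F = c * hom_eval (n, a) F" for a b c
    unfolding linear_dual_iff[OF vector_space_axioms] by auto
  show "hom_eval (n, 0) F = 0" using lin(1)[of 0 0] by (metis add_0_right add_left_imp_eq)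
qed

lemma series_form_in:
  assumes F: "F \<in> carr DC"
  shows "series_form F \<in> A_dual"
proof -
  have fin: "finite {n. F n \<noteq> 0}" using F by (simp add: DC_carr direct_sum_def)
  then obtain N where N: "\<And>n. F n \<noteq> 0 \<Longrightarrow> n < N" using finite_nat_set_iff_bounded by auto
  have "series_form F \<in> annihilator power_series_scale (tail N)"
    unfolding annihilator_def mem_Collect_eq linear_dual_iff[OF fps.vector_space_axioms]
  proof (intro conjI allI ballI)
    show "series_form F (f + g) = series_form F f + series_form F g" for f g
      by (simp add: series_form_def hom_eval_linear[OF F] sum.distrib)
    show "series_form F (power_series_scale c f) = c * series_form F f" for c f
      by (simp add: series_form_def hom_eval_linear[OF F] sum_distrib_left)
    show "series_form F f = 0" if "f \<in> tail N" for f
      unfolding series_form_def using that N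
      by (intro sum.neutral) (auto simp: tail_def hom_eval_linear[OF F])
  qed
  then show ?thesis unfolding finite_dual_eq by blast
qed

lemma series_form_monom:
  assumes F: "F \<in> carr DC"
  shows "series_form F (monom m) = hom_eval m F"
proof -
  obtain n a where m: "m = (n, a)" by (cases m)
  have fin: "finite {n. F n \<noteq> 0}" using F by (simp add: DC_carr direct_sum_def)
  have "series_form F (monom m) = (\<Sum>i | F i \<noteq> 0. if i = n then hom_eval (n, a) F else 0)"
    unfolding series_form_def m monom_nth by (intro sum.cong) (auto simp: hom_eval_linear[OF F])
  also have "\<dots> = hom_eval m F"
    using fin by (auto simp: m sum.delta hom_eval_def pointwise)
  finally show ?thesis .
qed

lemma series_form_surj:
  assumes f: "f \<in> A_dual"
  shows "\<exists>F\<in>carr DC. series_form F = f"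
proof -
  obtain N where N: "f \<in> annihilator power_series_scale (tail N)" using f finite_dual_eq by blast
  have lin: "f (x + y) = f x + f y" "f (power_series_scale c x) = c * f x" for x y c
    using N linear_dual_iff[OF fps.vector_space_axioms] by (auto simp: annihilator_def)
  have "(\<lambda>a. f (monom (n, a))) \<in> V" for n
  proof -
    have "monom (n, a + b) = monom (n, a) + monom (n, b)" "monom (n, scale c a) = power_series_scale c (monom (n, a))" for a b c
      by (auto simp: fps_eq_iff monom_nth)
    moreover have "f (monom (n, 0)) = 0" using lin(2)[of 0 "monom (n, 0)"] calculation(2)[of 0 0] by simp
    ultimately show ?thesis
      unfolding dual_carr annihilator_def by (simp add: linear_dual_iff[OF vector_space_axioms] lin)
  qed
  then have "\<exists>t\<in>Cn n. \<forall>a. t (E (a # replicate (n - 1) 1)) = f (monom (n, a))" for n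
    using Cn_exists by blast
  then obtain F where F: "\<And>n. F n \<in> Cn n" "\<And>n a. F n (E (a # replicate (n - 1) 1)) = f (monom (n, a))"
    by metis
  have "F n = 0" if "N \<le> n" for n
  proof (rule Cn_eqI[OF F(1) fs.subspace_0[OF subspace_Cn]])
    have "monom (n, a) \<in> tail N" for a using that by (auto simp: tail_def monom_nth)
    then show "F n (E (a # replicate (n - 1) 1)) = 0 (E (a # replicate (n - 1) 1))" for a
      unfolding F(2) zero_fun_apply using N by (simp add: annihilator_def)
  qed
  then have "{n. F n \<noteq> 0} \<subseteq> {..<N}" by (auto simp: not_less[symmetric])
  then have FX: "F \<in> carr DC" using F(1) by (auto simp: DC_carr direct_sum_def intro: finite_subset)
  have "hom_eval m F = f (monom m)" for m
    using F(2)[of "fst m" "snd m"] unfolding hom_eval_def prod.collapse .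
  then have "series_form F = f"
    by (intro A.eval_inject) (use f series_form_in[OF FX] in \<open>auto simp: A_carr series_form_monom[OF FX]\<close>)
  then show ?thesis using FX by blast
qed

lemma series_form_bij: "bij_betw series_form (carr DC) A_dual"
  unfolding bij_betw_def
proof
  show "inj_on series_form (carr DC)"
    by (rule inj_onI, rule hom.eval_inject) (auto simp flip: series_form_monom)
  show "series_form ` carr DC = A_dual" using series_form_in series_form_surj by blast
qed

text \<open>
  The terms of the formula for the comultiplication are tensors of words that need not lie in
  cotensor powers. Their sum does lie in the tensor square of the cotensor coalgebra, because it
  agrees with the transport of the comultiplication of the finite dual, as evaluation at all words
  shows.
\<close>

lemma DC_comult_hom_eval:
  assumes F: "F \<in> carr DC"
  shows "comult DC F \<in> tensor_space dsum_scale [carr DC, carr DC]"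
    and "comult DC F (eval_form hom_eval [m, n]) = hom_eval (hom_mult m n) F"
proof -
  let ?g = "inv_into (carr DC) series_form" and ?f = "series_form F"
  have f: "?f \<in> carr A_coalg" unfolding A_carr by (rule series_form_in[OF F])
  have g: "?g ` carr A_coalg \<subseteq> carr DC"
    unfolding A_carr using bij_betw_inv_into[OF series_form_bij] by (simp add: bij_betw_def)
  have eg: "hom_eval m (?g v) = v (monom m)" if "v \<in> carr A_coalg" for m v
    using that g bij_betw_inv_into_right[OF series_form_bij, of v] series_form_monom[of "?g v" m]
    unfolding A_carr by auto
  let ?T = "tensor_lift (scal A_coalg) [carr A_coalg, carr A_coalg] (\<lambda>ws. pure_tensor dsum_scale (map ?g ws)) (comult A_coalg ?f)"
  note map = tensor_map_eval[OF A.evaluations_axioms hom_evaluations g _ A.comult_in[OF f]]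
  have T_in: "?T \<in> tensor_space dsum_scale [carr DC, carr DC]" by (rule map(1)) (rule eg)
  have T_eval: "?T (eval_form hom_eval [m, n]) = hom_eval (hom_mult m n) F" for m n
  proof -
    have "?T (eval_form hom_eval [m, n]) = comult A_coalg ?f (eval_form (\<lambda>m f. f (monom m)) [m, n])"
      by (rule map(2)) (simp_all add: eg)
    then show ?thesis by (simp only: A.comult_eval[OF f] series_form_monom[OF F])
  qed
  have "comult DC F = ?T"
  proof (rule word.tensor_eqI[where Vs = "[V_seq, V_seq]"])
    show "comult DC F \<in> tensor_space dsum_scale [V_seq, V_seq]" by (rule DC_comult_word_eval(1)[OF F])
    show "?T \<in> tensor_space dsum_scale [V_seq, V_seq]"
      by (rule subsetD[OF tensor_space_mono T_in]) (use DC_subset in \<open>auto simp: set_Cons_def\<close>)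
    fix ws :: "(nat \<times> 'd list) list"
    assume "length ws = length [V_seq, V_seq]" "set ws \<subseteq> words"
    then obtain p ks q ls where ws: "ws = [(p, ks), (q, ls)]" and w: "(p, ks) \<in> words" "(q, ls) \<in> words"
      by (auto simp: length_Suc_conv)
    have "?T (eval_form word_eval ws) = ?T (eval_form hom_eval [(p, prod_list ks), (q, prod_list ls)])"
    proof (rule tensor_form_cong[OF T_in])
      show "multilinear_form dsum_scale (eval_form word_eval ws)"
        using w by (intro word.multilinear_eval) (simp add: ws)
      show "multilinear_form dsum_scale (eval_form hom_eval [(p, prod_list ks), (q, prod_list ls)])"
        by (intro hom.multilinear_eval) simp
      show "eval_form word_eval ws Fs = eval_form hom_eval [(p, prod_list ks), (q, prod_list ls)] Fs"
        if "Fs \<in> listset [carr DC, carr DC]" for Fs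
        using that w by (auto simp: set_Cons_def ws word_eval_DC)
    qed
    then show "comult DC F (eval_form word_eval ws) = ?T (eval_form word_eval ws)"
      using DC_comult_word_eval(2)[OF F w] by (simp add: T_eval ws del: eval_form.simps)
  qed simp
  with T_in T_eval show "comult DC F \<in> tensor_space dsum_scale [carr DC, carr DC]"
    and "comult DC F (eval_form hom_eval [m, n]) = hom_eval (hom_mult m n) F"
    by simp_all
qed

lemma DC_represented: "represented_coalgebra DC hom_eval hom_mult (0, 1)"
proof -
  interpret ev: evaluations "scal DC" "carr DC" UNIV hom_eval
    unfolding DC_scal by (rule hom_evaluations)
  interpret M: monoid hom_mult "(0, 1)" by (rule hom_mult_monoid)
  show ?thesis
    by unfold_locales (simp_all add: DC_scal DC_comult_hom_eval DC_counit_eval del: eval_form.simps)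
qed

end

theorem theorem5p9:
  fixes scale :: "'k::field \<Rightarrow> 'd::division_ring \<Rightarrow> 'd" and Basis :: "'d set"
  assumes "algebra_scale scale"
    and "finite_dimensional_vector_space scale Basis"
  shows "coalgebras_isomorphic (DC_id scale) (finite_dual_coalg (fps_scale scale))"
proof -
  interpret division_algebra scale Basis
    using assms by (simp add: division_algebra_def finite_dimensional_algebra_def finite_dimensional_algebra_axioms_def)
  have "coalgebra_iso DC A_coalg series_form"
    using series_form_bij
    by (intro represented_coalgebra_iso[OF DC_represented finite_dual_represented])
       (simp_all add: A_carr series_form_monom)
  then show ?thesis unfolding coalgebras_isomorphic_def by blast
qed

end
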